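(* Let $4<p<\infty$. There exist $f\in L_p(\mathbb{R})$ and $\Lambda\subseteq\mathbb{Z}$ such that $(f_{(\lambda)})_{\lambda\in\Lambda}$ is an unconditional basic sequence and $X_p(f,\Lambda)$ contains a subspace isomorphic to $L_p(\mathbb{R})$.
   Context: $f_{(\lambda)}(x)=f(x-\lambda)$, and $X_p(f,\Lambda)$ denotes the closed linear span in $L_p(\mathbb{R})$ of $\{f_{(\lambda)}:\lambda\in\Lambda\}$. Unconditional basic sequence: an unconditional Schauder basis of its closed linear span. *)

theory Defs
  imports "HOL-Analysis.Analysis"
begin

text \<open>Real-valued L_p(R) w.r.t. Lebesgue measure; elements are represented by functions,
  and all notions below are invariant under a.e. equality since they are phrased via the
  L_p (semi)norm.\<close>

definition Lp :: "real \<Rightarrow> (real \<Rightarrow> real) set" where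
  "Lp p = {g. g \<in> borel_measurable lebesgue \<and> integrable lebesgue (\<lambda>x. \<bar>g x\<bar> powr p)}"

definition Lp_norm :: "real \<Rightarrow> (real \<Rightarrow> real) \<Rightarrow> real" where
  "Lp_norm p g = (LINT x|lebesgue. \<bar>g x\<bar> powr p) powr (1 / p)"

definition translate :: "(real \<Rightarrow> real) \<Rightarrow> real \<Rightarrow> (real \<Rightarrow> real)" where
  "translate f l = (\<lambda>x. f (x - l))"

definition lin_comb :: "(real \<Rightarrow> real) \<Rightarrow> int set \<Rightarrow> (int \<Rightarrow> real) \<Rightarrow> (real \<Rightarrow> real)" where
  "lin_comb f F a = (\<lambda>x. \<Sum>l\<in>F. a l * translate f (real_of_int l) x)"

definition Xp :: "real \<Rightarrow> (real \<Rightarrow> real) \<Rightarrow> int set \<Rightarrow> (real \<Rightarrow> real) set" where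
  "Xp p f \<Lambda> = {g \<in> Lp p. \<forall>\<epsilon>>0. \<exists>F a. finite F \<and> F \<subseteq> \<Lambda> \<and>
       Lp_norm p (\<lambda>x. g x - lin_comb f F a x) < \<epsilon>}"

definition uncond_expansion :: "real \<Rightarrow> (real \<Rightarrow> real) \<Rightarrow> int set \<Rightarrow> (int \<Rightarrow> real) \<Rightarrow> (real \<Rightarrow> real) \<Rightarrow> bool" where
  "uncond_expansion p f \<Lambda> a g \<longleftrightarrow>
     (\<forall>\<epsilon>>0. \<exists>F0. finite F0 \<and> F0 \<subseteq> \<Lambda> \<and>
        (\<forall>F. finite F \<and> F0 \<subseteq> F \<and> F \<subseteq> \<Lambda> \<longrightarrow> Lp_norm p (\<lambda>x. g x - lin_comb f F a x) < \<epsilon>))"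

definition unconditional_basic :: "real \<Rightarrow> (real \<Rightarrow> real) \<Rightarrow> int set \<Rightarrow> bool" where
  "unconditional_basic p f \<Lambda> \<longleftrightarrow>
     (\<forall>l\<in>\<Lambda>. translate f (real_of_int l) \<in> Lp p) \<and>
     (\<forall>g\<in>Xp p f \<Lambda>. \<exists>!a. (\<forall>l. l \<notin> \<Lambda> \<longrightarrow> a l = 0) \<and> uncond_expansion p f \<Lambda> a g)"

definition contains_copy_of_Lp :: "real \<Rightarrow> (real \<Rightarrow> real) set \<Rightarrow> bool" where
  "contains_copy_of_Lp p X \<longleftrightarrow>
     (\<exists>T c C. 0 < c \<and>
        (\<forall>g\<in>Lp p. T g \<in> X \<and> c * Lp_norm p g \<le> Lp_norm p (T g) \<and> Lp_norm p (T g) \<le> C * Lp_norm p g) \<and>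
        (\<forall>g\<in>Lp p. \<forall>h\<in>Lp p. \<forall>a b::real.
            Lp_norm p (\<lambda>x. T (\<lambda>y. a * g y + b * h y) x - (a * T g x + b * T h x)) = 0))"

end

theory Submission
  imports Defs
begin

text \<open>
  Let \<open>f\<close> be the sum of functions \<open>u i\<close> on \<open>[0,1)\<close>, the \<open>i\<close>-th one moved to start at \<open>-3 ^ i\<close>, and
  let \<open>\<Lambda>\<close> consist of the powers of three. Differences of distinct powers of three are pairwise
  distinct, so the translates of \<open>f\<close> interact on \<open>[0,1)\<close> only, where the \<open>i\<close>-th translate is \<open>u i\<close>;
  elsewhere they have disjoint supports. Hence the \<open>p\<close>-th power of the norm of \<open>\<Sum> a i * f (x - 3 ^ i)\<close>
  is that of \<open>\<Sum> a i * u i\<close> plus a weighted \<open>\<ell>\<^sub>p\<close> sum of the \<open>a i\<close>.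

  Take \<open>u i\<close> to be a weight times the \<open>i\<close>-th Rademacher function times the indicator of a
  dyadic interval depending only on the first \<open>i\<close> binary digits. Then \<open>\<Sum> a i * u i\<close> is a dyadic
  martingale, and the square function inequality makes the translates unconditional. To each
  dyadic interval belongs a block of \<open>N\<close> indices with weight \<open>N powr (-1/4)\<close>; the sum of the
  translates in the block with coefficients \<open>N powr (-1/4)\<close> has on \<open>[0,1)\<close> the square function of a
  Haar function, while both the total mass of the block in \<open>f\<close> and the \<open>\<ell>\<^sub>p\<close> part of its norm are of
  order \<open>N powr (1 - p/4)\<close>, which is as small as we please because \<open>p > 4\<close>. So these block sums
  span a copy of the Haar system of \<open>L\<^sub>p[0,1)\<close>.
\<close>


subsection \<open>Inequalities for real powers\<close>

text \<open>The exponent 1/4 balances two demands. If a block of N indices has weights N^(-s) in f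
  and coefficients N^(-t), its square function is that of a Haar function when s + t = 1/2, while
  the mass of the block in f and its off-centre p-sum are of order N^(1 - s p) and N^(1 - t p). Both
  can be made small only if s and t exceed 1/p, which forces p > 4; s = t = 1/4 is the symmetric
  choice. Block k is made so long that both quantities are at most 4^(-k): a Haar coefficient of
  level l is controlled by the norm only up to a factor 2^(l - 1), which is at most 2^k, and 2^k
  4^(-k) is still summable. The sum is a martingale only if the interval attached to index i is
  known before digit i + 1 is drawn. The pairing function that numbers the triples (level, interval,
  member) grows fast enough to ensure this. A function on the line is first carried isometrically to
  [0,1). Its dyadic averages form a martingale whose increments are its Haar coefficients, and the
  same square function inequality, applied to this martingale and to the sum of translates, compares
  the two norms.\<close>

lemma powr_above_tangent:
  fixes a y m :: real
  assumes m: "1 \<le> m" and a: "0 \<le> a" and y: "0 \<le> y"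
  shows "a powr m + m * a powr (m - 1) * (y - a) \<le> y powr m"
proof -
  \<comment> \<open>The convexity argument lives on the open half line, so boundary values are split
    off. At \<open>a = 0\<close> the slope term vanishes even for \<open>m = 1\<close>, because
    \<open>0 powr 0 = 0\<close>.\<close>
  consider "a = 0" | "a > 0" "y = 0" | "a > 0" "y > 0" using a y by linarith
  then show ?thesis
  proof cases
    case 2
    have "a powr (m - 1) * a = a powr m"
      using 2 by (simp add: powr_mult_base mult.commute)
    then have "a powr m + m * a powr (m - 1) * (y - a) = (1 - m) * a powr m"
      using 2 by (simp add: algebra_simps)
    also have "\<dots> \<le> 0" using m by (simp add: mult_nonpos_nonneg)
    finally show ?thesis using 2 by simp
  next
    case 3
    have "y powr m - a powr m \<ge> (m * a powr (m - 1)) * (y - a)"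
    proof (rule convex_on_imp_above_tangent[of "{0<..}" "\<lambda>x. x powr m"])
      show "convex_on {0<..} (\<lambda>x. x powr m)" by (rule powr_convex[OF m])
      show "a \<in> interior {0<..}" using 3 by (simp add: interior_open)
      show "((\<lambda>x. x powr m) has_real_derivative m * a powr (m - 1)) (at a within {0<..})"
        using 3 by (auto intro!: derivative_eq_intros)
    qed (use 3 in auto)
    then show ?thesis by simp
  qed (use m in auto)
qed

lemma powr_superadditive:
  fixes a b m :: real
  assumes "1 \<le> m" "0 \<le> a" "0 \<le> b"
  shows "a powr m + b powr m \<le> (a + b) powr m"
proof (cases "a = 0 \<or> b = 0")
  case False
  then have ab: "a > 0" "b > 0" using assms by auto
  have *: "c powr m = c * c powr (m - 1)" if "c > 0" for c :: real
    using that by (simp add: powr_mult_base)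
  have "a * a powr (m-1) + b * b powr (m-1) \<le> a * (a + b) powr (m-1) + b * (a + b) powr (m-1)"
    using assms ab by (intro add_mono mult_left_mono powr_mono2) auto
  also have "\<dots> = (a + b) * (a + b) powr (m-1)" by (simp add: algebra_simps)
  finally show ?thesis using ab *[of a] *[of b] *[of "a+b"] by simp
qed auto

lemma powr_abs_add_diff:
  fixes x d p :: real
  shows "\<bar>x + d\<bar> powr p + \<bar>x - d\<bar> powr p = (\<bar>x\<bar> + \<bar>d\<bar>) powr p + \<bar>\<bar>x\<bar> - \<bar>d\<bar>\<bar> powr p"
proof -
  have "(\<bar>x + d\<bar> = \<bar>x\<bar> + \<bar>d\<bar> \<and> \<bar>x - d\<bar> = \<bar>\<bar>x\<bar> - \<bar>d\<bar>\<bar>) \<or>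
     (\<bar>x - d\<bar> = \<bar>x\<bar> + \<bar>d\<bar> \<and> \<bar>x + d\<bar> = \<bar>\<bar>x\<bar> - \<bar>d\<bar>\<bar>)" by (auto simp: abs_if)
  then show ?thesis by auto
qed

text \<open>Tangents of t^r at |x| are evaluated at |x + d| and |x - d|; the linear terms add up to
  something nonnegative since |x + d| + |x - d| >= 2|x|.\<close>

lemma powr_abs_midpoint:
  fixes x d r :: real
  assumes "1 \<le> r"
  shows "2 * \<bar>x\<bar> powr r \<le> \<bar>x + d\<bar> powr r + \<bar>x - d\<bar> powr r"
proof -
  let ?k = "r * \<bar>x\<bar> powr (r - 1)"
  have "\<bar>x\<bar> powr r + ?k * (\<bar>x + d\<bar> - \<bar>x\<bar>) \<le> \<bar>x + d\<bar> powr r"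
    and "\<bar>x\<bar> powr r + ?k * (\<bar>x - d\<bar> - \<bar>x\<bar>) \<le> \<bar>x - d\<bar> powr r"
    using assms by (auto intro!: powr_above_tangent)
  moreover have "0 \<le> ?k * (\<bar>x + d\<bar> + \<bar>x - d\<bar> - 2 * \<bar>x\<bar>)"
    using assms by (intro mult_nonneg_nonneg) auto
  ultimately show ?thesis by (simp add: algebra_simps)
qed

text \<open>The difference \<open>h\<close> of the two sides starts at \<open>h 0 = -2\<close> and
  is nondecreasing, so only its first derivative has to be examined.\<close>

lemma powr_second_difference_unit:
  fixes p t :: real
  assumes p: "2 \<le> p" and t: "0 \<le> t" "t < 1"
  shows "(1 + t) powr p + (1 - t) powr p \<le> 2 + p * (p - 1) * 2 powr (p - 2) * t\<^sup>2"
proof -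
  define C where "C = p * (p - 1) * 2 powr (p - 2)"
  define h where "h = (\<lambda>t::real. C * t\<^sup>2 - (1 + t) powr p - (1 - t) powr p)"
  have "h 0 \<le> h t"
  proof (rule DERIV_nonneg_imp_nondecreasing[OF t(1)])
    fix s assume s: "0 \<le> s" "s \<le> t"
    then have s1: "s < 1" using t by simp
    define D where "D = 2 * C * s - p * ((1 + s) powr (p - 1) - (1 - s) powr (p - 1))"
    have "(h has_real_derivative D) (at s)"
      unfolding h_def D_def using s s1
      by (auto intro!: derivative_eq_intros simp: algebra_simps)
    moreover have "D \<ge> 0"
    proof -
      \<comment> \<open>The tangent at 1 + s bounds the difference of the (p-1)-th powers by the
        slope there times 2 s; 1 + s <= 2 then gives the factor 2^(p-2).\<close>
      have "(1 + s) powr (p-1) + (p-1) * (1 + s) powr (p-1-1) * ((1 - s) - (1 + s)) \<le> (1 - s) powr (p-1)"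
        using p s s1 by (intro powr_above_tangent) auto
      then have "(1 + s) powr (p-1) - (1 - s) powr (p-1) \<le> (p-1) * (1 + s) powr (p-2) * (2 * s)"
        by (simp add: algebra_simps)
      also have "\<dots> \<le> (p-1) * 2 powr (p-2) * (2 * s)"
        using p s s1 by (intro mult_right_mono mult_left_mono powr_mono2) auto
      finally have "p * ((1 + s) powr (p-1) - (1 - s) powr (p-1)) \<le> p * ((p-1) * 2 powr (p-2) * (2 * s))"
        using p by (intro mult_left_mono) auto
      then show ?thesis unfolding D_def C_def by (simp add: mult_ac)
    qed
    ultimately show "\<exists>y. (h has_real_derivative y) (at s) \<and> 0 \<le> y" by blast
  qed
  then show ?thesis by (simp add: h_def C_def)
qed

lemma power2_eq_powr_abs: "x\<^sup>2 = \<bar>x\<bar> powr 2" for x :: real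
  by (cases "x = 0") simp_all

lemma powr_abs_mult_power2: "\<bar>x\<bar> powr (p - 2) * x\<^sup>2 = \<bar>x\<bar> powr p" for x p :: real
  unfolding power2_eq_powr_abs powr_add[symmetric] by simp

text \<open>For |d| < |x| homogeneity reduces to the unit case with t = |d|/|x|; otherwise both
  terms on the left are at most (2|d|)^p. The two summands of \<open>C\<close> serve these two
  cases.\<close>

lemma powr_second_difference:
  fixes p x d :: real
  assumes p: "2 \<le> p"
  defines "C \<equiv> p * (p - 1) * 2 powr (p - 2) + 2 * 2 powr p"
  shows "\<bar>x + d\<bar> powr p + \<bar>x - d\<bar> powr p \<le>
    2 * \<bar>x\<bar> powr p + C * (\<bar>x\<bar> powr (p - 2) * d\<^sup>2 + \<bar>d\<bar> powr p)"
proof -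
  define C1 where "C1 = p * (p - 1) * 2 powr (p - 2)"
  have C1: "0 \<le> C1" using p by (simp add: C1_def)
  have C: "C1 \<le> C" "2 * 2 powr p \<le> C" "0 \<le> C" using C1 by (auto simp: C_def C1_def)
  show ?thesis
  proof (cases "\<bar>d\<bar> < \<bar>x\<bar>")
    case True
    define t where "t = \<bar>d\<bar> / \<bar>x\<bar>"
    have t: "0 \<le> t" "t < 1" "\<bar>d\<bar> = \<bar>x\<bar> * t" using True by (auto simp: t_def)
    have x: "\<bar>x\<bar> > 0" using True by auto
    have "\<bar>x + d\<bar> powr p + \<bar>x - d\<bar> powr p = (\<bar>x\<bar> * (1 + t)) powr p + (\<bar>x\<bar> * (1 - t)) powr p"
      unfolding powr_abs_add_diff using True t by (simp add: algebra_simps)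
    also have "\<dots> = \<bar>x\<bar> powr p * ((1 + t) powr p + (1 - t) powr p)"
      using t powr_mult[of "\<bar>x\<bar>" "1 + t" p] powr_mult[of "\<bar>x\<bar>" "1 - t" p]
      by (simp only: distrib_left abs_ge_zero)
    also have "\<dots> \<le> \<bar>x\<bar> powr p * (2 + C1 * t\<^sup>2)"
      using powr_second_difference_unit[OF p t(1,2)] by (intro mult_left_mono) (auto simp: C1_def)
    also have "\<dots> = 2 * \<bar>x\<bar> powr p + C1 * (\<bar>x\<bar> powr p * t\<^sup>2)" by (simp add: algebra_simps)
    also have "\<bar>x\<bar> powr p * t\<^sup>2 = \<bar>x\<bar> powr (p - 2) * d\<^sup>2"
    proof -
      have "\<bar>x\<bar> powr p = \<bar>x\<bar> powr (p - 2) * \<bar>x\<bar>\<^sup>2"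
        by (simp add: powr_abs_mult_power2)
      then have "\<bar>x\<bar> powr p * t\<^sup>2 = \<bar>x\<bar> powr (p - 2) * (\<bar>x\<bar> * t)\<^sup>2" by (simp add: power_mult_distrib)
      then show ?thesis by (simp flip: t(3))
    qed
    also have "C1 * (\<bar>x\<bar> powr (p - 2) * d\<^sup>2) \<le> C * (\<bar>x\<bar> powr (p - 2) * d\<^sup>2)"
      using C by (intro mult_right_mono) auto
    finally have "\<bar>x + d\<bar> powr p + \<bar>x - d\<bar> powr p \<le> 2 * \<bar>x\<bar> powr p + C * (\<bar>x\<bar> powr (p - 2) * d\<^sup>2)"
      by simp
    moreover have "0 \<le> C * \<bar>d\<bar> powr p" using C by simp
    ultimately show ?thesis by (simp add: algebra_simps)
  next
    case False
    have "\<bar>x + d\<bar> powr p + \<bar>x - d\<bar> powr p \<le> (2 * \<bar>d\<bar>) powr p + (2 * \<bar>d\<bar>) powr p"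
      using False p by (intro add_mono powr_mono2) auto
    also have "\<dots> = (2 * 2 powr p) * \<bar>d\<bar> powr p" by (simp add: powr_mult)
    also have "\<dots> \<le> C * \<bar>d\<bar> powr p" using C by (intro mult_right_mono) auto
    also have "\<dots> \<le> 2 * \<bar>x\<bar> powr p + C * (\<bar>x\<bar> powr (p - 2) * d\<^sup>2 + \<bar>d\<bar> powr p)"
      using C by (simp add: algebra_simps)
    finally show ?thesis .
  qed
qed

text \<open>Either K v is at most u/2, and half of u^s suffices, or u is less than 2 K v and can be
  replaced by it. The factor 1/2 leaves room to absorb the first term on the other side of an
  inequality.\<close>

lemma Young_half_absorb:
  fixes u v K s :: real
  assumes "1 \<le> s" "0 \<le> u" "0 \<le> v" "0 \<le> K"
  shows "K * u powr (s - 1) * v \<le> u powr s / 2 + (2 * K) powr s * v powr s"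
proof (cases "K * v \<le> u / 2")
  case True
  have "K * u powr (s - 1) * v = u powr (s - 1) * (K * v)" by simp
  also have "\<dots> \<le> u powr (s - 1) * (u / 2)" by (intro mult_left_mono True) auto
  also have "\<dots> = u powr s / 2" using assms by (cases "u = 0") (auto simp: powr_mult_base mult.commute)
  finally show ?thesis by (simp add: add_increasing2)
next
  case False
  then have *: "u \<le> 2 * K * v" by simp
  have "K * v > 0" using False assms(2) by linarith
  then have pos: "2 * K * v > 0" by simp
  have "K * u powr (s - 1) * v \<le> (2 * K * v) * u powr (s - 1)"
    using assms by (simp add: mult_ac)
  also have "\<dots> \<le> (2 * K * v) * (2 * K * v) powr (s - 1)"
    using assms * pos by (intro mult_left_mono powr_mono2) auto
  also have "\<dots> = (2 * K * v) powr s" using pos by (simp add: powr_mult_base)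
  also have "\<dots> = (2 * K) powr s * v powr s" using assms by (simp add: powr_mult)
  finally show ?thesis by (simp add: add_increasing)
qed

subsection \<open>The square function inequality for dyadic martingales\<close>

lemma power2_powr_half:
  fixes x p :: real
  shows "(x\<^sup>2) powr (p / 2) = \<bar>x\<bar> powr p"
  unfolding power2_eq_powr_abs powr_powr by simp

lemma power2_powr_half_minus_one:
  fixes x p :: real
  shows "(x\<^sup>2) powr (p / 2 - 1) = \<bar>x\<bar> powr (p - 2)"
  using power2_powr_half[of x "p - 2"] by (simp add: diff_divide_distrib)

text \<open>A dyadic martingale stored by its values on the intervals of level n:
  \<open>j div 2\<close> is the parent of interval j, the parity of j tells which half it is, and
  \<open>W n\<close> is the predictable size of the increment.\<close>

primrec dyadic_mart :: "real \<Rightarrow> (nat \<Rightarrow> nat \<Rightarrow> real) \<Rightarrow> nat \<Rightarrow> nat \<Rightarrow> real" where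
  "dyadic_mart a W 0 j = a"
| "dyadic_mart a W (Suc n) j = dyadic_mart a W n (j div 2) + (-1) ^ j * W n (j div 2)"

primrec dyadic_sq :: "real \<Rightarrow> (nat \<Rightarrow> nat \<Rightarrow> real) \<Rightarrow> nat \<Rightarrow> nat \<Rightarrow> real" where
  "dyadic_sq a W 0 j = a\<^sup>2"
| "dyadic_sq a W (Suc n) j = dyadic_sq a W n (j div 2) + (W n (j div 2))\<^sup>2"

lemma dyadic_sq_nonneg [simp]: "0 \<le> dyadic_sq a W n j"
  by (induction n arbitrary: j) auto

lemma sum_lessThan_double:
  fixes g :: "nat \<Rightarrow> 'a :: comm_monoid_add"
  shows "(\<Sum>j<2 * m. g j) = (\<Sum>j<m. g (2 * j) + g (2 * j + 1))"
  by (induction m) (simp_all add: add_ac)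

text \<open>Both square function inequalities are obtained in the style of Burkholder: along a dyadic martingale
  \<open>x\<close> with square function \<open>q\<close> (the sum of the squared increments), the expectation of \<open>F x q\<close> does not
  increase for the explicit functions \<open>F\<close> chosen below, and Young's inequality absorbs the mixed term of \<open>F\<close>.\<close>

lemma dyadic_supersolution:
  fixes F :: "real \<Rightarrow> real \<Rightarrow> real"
  assumes F: "\<And>x d q. 0 \<le> q \<Longrightarrow> F (x + d) (q + d\<^sup>2) + F (x - d) (q + d\<^sup>2) \<le> 2 * F x q"
  shows "(\<Sum>j<2 ^ n. F (dyadic_mart a W n j) (dyadic_sq a W n j)) \<le> 2 ^ n * F a (a\<^sup>2)"
proof (induction n)
  case (Suc n)
  have "(\<Sum>j<2 ^ Suc n. F (dyadic_mart a W (Suc n) j) (dyadic_sq a W (Suc n) j))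
      = (\<Sum>j<2 ^ n. F (dyadic_mart a W n j + W n j) (dyadic_sq a W n j + (W n j)\<^sup>2)
             + F (dyadic_mart a W n j - W n j) (dyadic_sq a W n j + (W n j)\<^sup>2))"
    by (simp only: power_Suc sum_lessThan_double) simp
  also have "\<dots> \<le> (\<Sum>j<2 ^ n. 2 * F (dyadic_mart a W n j) (dyadic_sq a W n j))"
    by (intro sum_mono F) simp
  also have "\<dots> \<le> 2 * (2 ^ n * F a (a\<^sup>2))"
    using Suc.IH by (simp flip: sum_distrib_left)
  finally show ?case by simp
qed simp

text \<open>\<open>F\<close> subtracts from |x|^p what its second difference can produce. Adding d^2
  to q in the mixed term pays for |x|^(p-2) d^2, by midpoint convexity of |x|^(p-2), which is where
  p >= 3 enters; adding it in q^(p/2) pays for |d|^p, by superadditivity.\<close>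

lemma dyadic_mart_le_sq:
  assumes p: "3 \<le> p"
  shows "\<exists>C>0. \<forall>a W n. (\<Sum>j<2 ^ n. \<bar>dyadic_mart a W n j\<bar> powr p)
      \<le> C * (\<Sum>j<2 ^ n. dyadic_sq a W n j powr (p / 2))"
proof -
  define A where "A = p * (p - 1) * 2 powr (p - 2) + 2 * 2 powr p"
  have A1: "1 \<le> A"
  proof -
    have "1 \<le> 2 powr p" using p by (simp add: ge_one_powr_ge_zero)
    moreover have "0 \<le> p * (p - 1) * 2 powr (p - 2)" using p by simp
    ultimately show ?thesis unfolding A_def by linarith
  qed
  define F where "F = (\<lambda>x q. \<bar>x\<bar> powr p - A * \<bar>x\<bar> powr (p - 2) * q - A * q powr (p / 2))"
  have F: "F (x + d) (q + d\<^sup>2) + F (x - d) (q + d\<^sup>2) \<le> 2 * F x q" if q: "0 \<le> q" for x d q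
  proof -
    have "\<bar>x + d\<bar> powr p + \<bar>x - d\<bar> powr p \<le> 2 * \<bar>x\<bar> powr p + A * (\<bar>x\<bar> powr (p - 2) * d\<^sup>2 + \<bar>d\<bar> powr p)"
      unfolding A_def using p by (intro powr_second_difference) auto
    moreover have "(A * (q + d\<^sup>2)) * (2 * \<bar>x\<bar> powr (p - 2)) \<le> (A * (q + d\<^sup>2)) * (\<bar>x + d\<bar> powr (p - 2) + \<bar>x - d\<bar> powr (p - 2))"
      using p q A1 by (intro mult_left_mono powr_abs_midpoint) auto
    moreover have "A * (q powr (p / 2) + \<bar>d\<bar> powr p) \<le> A * (q + d\<^sup>2) powr (p / 2)"
      using p q A1 powr_superadditive[of "p / 2" q "d\<^sup>2"]
      by (intro mult_left_mono) (auto simp: power2_powr_half)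
    moreover have "0 \<le> A * (\<bar>x\<bar> powr (p - 2) * d\<^sup>2)" "0 \<le> A * \<bar>d\<bar> powr p" using A1 by auto
    ultimately show ?thesis unfolding F_def by (simp add: algebra_simps)
  qed
  define K where "K = (2 * A) powr (p / 2) + A"
  define C where "C = 2 * K"
  have "(\<Sum>j<2 ^ n. \<bar>dyadic_mart a W n j\<bar> powr p)
      \<le> C * (\<Sum>j<2 ^ n. dyadic_sq a W n j powr (p / 2))" for a W n
  proof -
    let ?x = "dyadic_mart a W n" and ?q = "dyadic_sq a W n"
    have *: "\<bar>x\<bar> powr p / 2 - K * q powr (p / 2) \<le> F x q"
      if "0 \<le> q" for x q
      using Young_half_absorb[of "p / 2" "x\<^sup>2" q A] p A1 that
      unfolding F_def K_def power2_powr_half power2_powr_half_minus_one by (simp add: algebra_simps)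
    have "(\<Sum>j<2 ^ n. \<bar>?x j\<bar> powr p / 2 - K * ?q j powr (p / 2))
        \<le> (\<Sum>j<2 ^ n. F (?x j) (?q j))"
      by (intro sum_mono *) simp
    also have "\<dots> \<le> 2 ^ n * F a (a\<^sup>2)" by (rule dyadic_supersolution[OF F])
    \<comment> \<open>The starting value is nonpositive because \<open>A\<close> is at least 1, so
      the expectation of \<open>F\<close> stays nonpositive for all n.\<close>
    also have "F a (a\<^sup>2) = \<bar>a\<bar> powr p * (1 - 2 * A)"
      using powr_abs_mult_power2[of a p]
      unfolding F_def power2_powr_half by (simp add: algebra_simps)
    also have "2 ^ n * (\<bar>a\<bar> powr p * (1 - 2 * A)) \<le> 0"
      using A1 by (intro mult_nonneg_nonpos) auto
    finally show ?thesis
      by (simp add: C_def sum_subtractf sum_distrib_left[symmetric] sum_divide_distrib[symmetric] algebra_simps)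
  qed
  moreover have "C > 0" using A1 unfolding C_def K_def by (intro mult_pos_pos add_nonneg_pos) auto
  ultimately show ?thesis by blast
qed

text \<open>One step raises the mean of x^2 by d^2, so the mixed term of \<open>F\<close> falls by
  at least m d^2 (q + d^2)^(m-1); by the tangent inequality at q + d^2 this outweighs the growth of
  q^m.\<close>

lemma dyadic_sq_le_mart:
  assumes p: "4 < p"
  shows "\<exists>C>0. \<forall>a W n. (\<Sum>j<2 ^ n. dyadic_sq a W n j powr (p / 2))
      \<le> C * (\<Sum>j<2 ^ n. \<bar>dyadic_mart a W n j\<bar> powr p)"
proof -
  define m where "m = p / 2"
  have m: "2 < m" "p / 2 = m" using p by (auto simp: m_def)
  define F where "F = (\<lambda>x q::real. q powr m - m * x\<^sup>2 * q powr (m - 1))"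
  have F: "F (x + d) (q + d\<^sup>2) + F (x - d) (q + d\<^sup>2) \<le> 2 * F x q" if q: "0 \<le> q" for x d q
  proof -
    have "(q + d\<^sup>2) powr m + m * (q + d\<^sup>2) powr (m - 1) * (q - (q + d\<^sup>2)) \<le> q powr m"
      using m q by (intro powr_above_tangent) auto
    moreover have "(m * x\<^sup>2) * q powr (m - 1) \<le> (m * x\<^sup>2) * (q + d\<^sup>2) powr (m - 1)"
      using m q by (intro mult_left_mono powr_mono2) auto
    ultimately show ?thesis
      unfolding F_def by (simp add: power2_eq_square algebra_simps)
  qed
  define C where "C = 2 * (2 * m) powr m"
  have "(\<Sum>j<2 ^ n. dyadic_sq a W n j powr m) \<le> C * (\<Sum>j<2 ^ n. \<bar>dyadic_mart a W n j\<bar> powr p)" for a W n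
  proof -
    let ?x = "dyadic_mart a W n" and ?q = "dyadic_sq a W n"
    have *: "q powr m / 2 - (2 * m) powr m * \<bar>x\<bar> powr p \<le> F x q" if "0 \<le> q" for x q
      using Young_half_absorb[of m q "x\<^sup>2" m] m(1) that power2_powr_half[of x p]
      unfolding F_def m(2) by (simp add: algebra_simps)
    have "(\<Sum>j<2 ^ n. ?q j powr m / 2 - (2 * m) powr m * \<bar>?x j\<bar> powr p) \<le> (\<Sum>j<2 ^ n. F (?x j) (?q j))"
      by (intro sum_mono *) simp
    also have "\<dots> \<le> 2 ^ n * F a (a\<^sup>2)" by (rule dyadic_supersolution[OF F])
    also have "F a (a\<^sup>2) = (a\<^sup>2) powr m * (1 - m)"
      using m by (cases "a = 0") (simp_all add: F_def powr_mult_base mult.assoc algebra_simps)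
    also have "2 ^ n * ((a\<^sup>2) powr m * (1 - m)) \<le> 0"
      using m by (intro mult_nonneg_nonpos) auto
    finally show ?thesis
      by (simp add: C_def sum_subtractf sum_distrib_left[symmetric] sum_divide_distrib[symmetric] algebra_simps)
  qed
  moreover have "C > 0" using m by (simp add: C_def)
  ultimately show ?thesis using m(2) by metis
qed

subsection \<open>The spaces L_p of the line\<close>

text \<open>Estimates are made for p-th powers of norms, which add over disjoint supports. The
  triangle inequality is replaced by its crude form with factor 2^p, and norms return only at the
  interface with the given definitions.\<close>

definition Lp_int :: "real \<Rightarrow> (real \<Rightarrow> real) \<Rightarrow> real" where
  "Lp_int p g = (LINT x|lebesgue. \<bar>g x\<bar> powr p)"

lemma Lp_int_nonneg [simp]: "0 \<le> Lp_int p g"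
  by (simp add: Lp_int_def)

lemma Lp_norm_eq: "Lp_norm p g = Lp_int p g powr (1 / p)"
  by (simp add: Lp_norm_def Lp_int_def)

lemma Lp_norm_less_iff:
  assumes "0 < p" "0 < e"
  shows "Lp_norm p g < e \<longleftrightarrow> Lp_int p g < e powr p"
proof -
  have "Lp_norm p g < e \<longleftrightarrow> Lp_norm p g powr p < e powr p"
    using assms powr_less_mono2[of p "Lp_norm p g" e] powr_mono2[of p e "Lp_norm p g"]
    by (auto simp: Lp_norm_eq not_less[symmetric])
  moreover have "Lp_norm p g powr p = Lp_int p g"
    using assms by (simp add: Lp_norm_eq powr_powr)
  ultimately show ?thesis by simp
qed

lemma LpI: "g \<in> borel_measurable lebesgue \<Longrightarrow> integrable lebesgue (\<lambda>x. \<bar>g x\<bar> powr p) \<Longrightarrow> g \<in> Lp p"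
  by (simp add: Lp_def)

lemma Lp_measurable: "g \<in> Lp p \<Longrightarrow> g \<in> borel_measurable lebesgue"
  and Lp_integrable: "g \<in> Lp p \<Longrightarrow> integrable lebesgue (\<lambda>x. \<bar>g x\<bar> powr p)"
  by (simp_all add: Lp_def)

lemma powr_abs_add_le:
  fixes a b p :: real
  assumes "0 \<le> p"
  shows "\<bar>a + b\<bar> powr p \<le> 2 powr p * (\<bar>a\<bar> powr p + \<bar>b\<bar> powr p)"
proof -
  have *: "(2 * max \<bar>a\<bar> \<bar>b\<bar>) powr p = 2 powr p * max \<bar>a\<bar> \<bar>b\<bar> powr p"
    by (simp add: powr_mult)
  have "\<bar>a + b\<bar> powr p \<le> (2 * max \<bar>a\<bar> \<bar>b\<bar>) powr p"
    using assms by (intro powr_mono2) auto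
  also have "\<dots> \<le> 2 powr p * (\<bar>a\<bar> powr p + \<bar>b\<bar> powr p)"
    unfolding * by (intro mult_left_mono) (auto simp: max_def)
  finally show ?thesis .
qed

lemma Lp_add:
  assumes "0 \<le> p" "g \<in> Lp p" "h \<in> Lp p"
  shows "(\<lambda>x. g x + h x) \<in> Lp p"
    and "Lp_int p (\<lambda>x. g x + h x) \<le> 2 powr p * (Lp_int p g + Lp_int p h)"
proof -
  note [measurable] = Lp_measurable[OF assms(2)] Lp_measurable[OF assms(3)]
  note int = Lp_integrable[OF assms(2)] Lp_integrable[OF assms(3)]
  have *: "integrable lebesgue (\<lambda>x. 2 powr p * (\<bar>g x\<bar> powr p + \<bar>h x\<bar> powr p))"
    using int by auto
  have int2: "integrable lebesgue (\<lambda>x. \<bar>g x + h x\<bar> powr p)"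
    by (rule Bochner_Integration.integrable_bound[OF *]) (use assms powr_abs_add_le in auto)
  show "(\<lambda>x. g x + h x) \<in> Lp p" by (rule LpI[OF _ int2]) measurable
  have "Lp_int p (\<lambda>x. g x + h x) \<le> (LINT x|lebesgue. 2 powr p * (\<bar>g x\<bar> powr p + \<bar>h x\<bar> powr p))"
    unfolding Lp_int_def by (intro integral_mono int2 * powr_abs_add_le assms)
  also have "\<dots> = 2 powr p * (Lp_int p g + Lp_int p h)"
    using int by (simp add: Lp_int_def)
  finally show "Lp_int p (\<lambda>x. g x + h x) \<le> 2 powr p * (Lp_int p g + Lp_int p h)" .
qed

lemma Lp_scale:
  assumes "g \<in> Lp p"
  shows "(\<lambda>x. c * g x) \<in> Lp p" and "Lp_int p (\<lambda>x. c * g x) = \<bar>c\<bar> powr p * Lp_int p g"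
  using assms by (auto simp: Lp_def Lp_int_def abs_mult powr_mult)

lemma Lp_diff:
  assumes "0 \<le> p" "g \<in> Lp p" "h \<in> Lp p"
  shows "(\<lambda>x. g x - h x) \<in> Lp p"
    and "Lp_int p (\<lambda>x. g x - h x) \<le> 2 powr p * (Lp_int p g + Lp_int p h)"
  using Lp_add[OF assms(1,2) Lp_scale(1)[OF assms(3), of "-1"]] Lp_scale(2)[OF assms(3), of "-1"]
  by simp_all

lemma Lp_zero: "(\<lambda>x. 0) \<in> Lp p" and Lp_int_zero [simp]: "Lp_int p (\<lambda>x. 0) = 0"
  by (simp_all add: Lp_def Lp_int_def)

lemma Lp_sum:
  assumes "0 \<le> p" "\<And>i. i \<in> F \<Longrightarrow> g i \<in> Lp p"
  shows "(\<lambda>x. \<Sum>i\<in>F. g i x) \<in> Lp p"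
proof (cases "finite F")
  case True
  then show ?thesis using assms(2)
    by (induction F rule: finite_induct) (auto intro: Lp_zero Lp_add(1)[OF assms(1)])
qed (simp add: Lp_zero)

lemma Lp_int_minus_commute: "Lp_int p (\<lambda>x. g x - h x) = Lp_int p (\<lambda>x. h x - g x)"
  by (simp add: Lp_int_def abs_minus_commute)

lemma Lp_int_triangle:
  assumes "0 \<le> p" "f \<in> Lp p" "g \<in> Lp p" "h \<in> Lp p"
  shows "Lp_int p (\<lambda>x. f x - h x) \<le> 2 powr p * (Lp_int p (\<lambda>x. f x - g x) + Lp_int p (\<lambda>x. g x - h x))"
  using Lp_add(2)[OF assms(1) Lp_diff(1)[OF assms(1-3)] Lp_diff(1)[OF assms(1,3,4)]] by simp

lemma translate_Lp:
  assumes "f \<in> Lp p"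
  shows "translate f c \<in> Lp p" and "Lp_int p (translate f c) = Lp_int p f"
proof -
  have m: "(\<lambda>x::real. x - c) \<in> lebesgue \<rightarrow>\<^sub>M lebesgue"
    using lebesgue_affine_measurable[of "\<lambda>_::real. 1" "-c"] by simp
  note f = Lp_measurable[OF assms] Lp_integrable[OF assms]
  have "(\<lambda>x. f (x - c)) \<in> borel_measurable lebesgue"
    using measurable_compose[OF m f(1)] by simp
  moreover have "has_bochner_integral lebesgue (\<lambda>x. \<bar>f (x - c)\<bar> powr p) (Lp_int p f)"
    using has_bochner_integral_lebesgue_real_affine_iff[of 1 "\<lambda>x. \<bar>f x\<bar> powr p" "Lp_int p f" "-c"]
      has_bochner_integral_integrable[OF f(2)] by (simp add: Lp_int_def)
  ultimately show "translate f c \<in> Lp p" "Lp_int p (translate f c) = Lp_int p f"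
    by (auto simp: translate_def Lp_def Lp_int_def has_bochner_integral_iff)
qed

lemma lin_comb_Lp: "0 \<le> p \<Longrightarrow> f \<in> Lp p \<Longrightarrow> lin_comb f F a \<in> Lp p"
  unfolding lin_comb_def by (intro Lp_sum Lp_scale translate_Lp)

text \<open>Fatou's lemma, which yields membership in L_p together with the bound.\<close>

lemma Lp_int_le_liminf:
  assumes g: "g \<in> borel_measurable lebesgue" and G: "\<And>k. G k \<in> Lp p"
    and conv: "AE x in lebesgue. (\<lambda>k. G k x) \<longlonglongrightarrow> g x"
    and p: "0 < p" and bd: "\<And>k. Lp_int p (G k) \<le> e"
  shows "g \<in> Lp p" and "Lp_int p g \<le> e"
proof -
  note [measurable] = g Lp_measurable[OF G]
  have e: "0 \<le> e" using bd[of 0] Lp_int_nonneg order_trans by blast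
  have "(\<integral>\<^sup>+x. ennreal (\<bar>g x\<bar> powr p) \<partial>lebesgue)
      = (\<integral>\<^sup>+x. liminf (\<lambda>k. ennreal (\<bar>G k x\<bar> powr p)) \<partial>lebesgue)"
  proof (rule nn_integral_cong_AE)
    show "AE x in lebesgue. ennreal (\<bar>g x\<bar> powr p) = liminf (\<lambda>k. ennreal (\<bar>G k x\<bar> powr p))"
      using conv
    proof eventually_elim
      case (elim x)
      have "(\<lambda>k. \<bar>G k x\<bar> powr p) \<longlonglongrightarrow> \<bar>g x\<bar> powr p"
        using elim p by (intro tendsto_powr2 tendsto_rabs tendsto_const) auto
      then have "(\<lambda>k. ennreal (\<bar>G k x\<bar> powr p)) \<longlonglongrightarrow> ennreal (\<bar>g x\<bar> powr p)"
        by (intro tendsto_ennrealI)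
      from lim_imp_Liminf[OF _ this] show ?case by simp
    qed
  qed
  also have "\<dots> \<le> liminf (\<lambda>k. \<integral>\<^sup>+x. ennreal (\<bar>G k x\<bar> powr p) \<partial>lebesgue)"
    by (rule nn_integral_liminf) measurable
  also have "\<dots> \<le> ennreal e"
  proof (rule Liminf_le)
    show "\<forall>\<^sub>F k in sequentially. (\<integral>\<^sup>+x. ennreal (\<bar>G k x\<bar> powr p) \<partial>lebesgue) \<le> ennreal e"
      using bd e Lp_integrable[OF G]
      by (auto simp: nn_integral_eq_integral Lp_int_def intro!: always_eventually ennreal_leI)
  qed simp
  finally have *: "(\<integral>\<^sup>+x. ennreal (\<bar>g x\<bar> powr p) \<partial>lebesgue) \<le> ennreal e" .
  have int: "integrable lebesgue (\<lambda>x. \<bar>g x\<bar> powr p)"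
    by (rule integrableI_bounded) (use * in \<open>auto simp: le_less_trans ennreal_less_top\<close>)
  show "g \<in> Lp p" by (rule LpI[OF g int])
  show "Lp_int p g \<le> e"
    using * e int by (simp add: nn_integral_eq_integral Lp_int_def)
qed

text \<open>After multiplication by 2^(p k) the p-th powers of the increments still have summable
  integrals. At almost every x they are therefore bounded by some M, and the increments are
  dominated by the geometric series M^(1/p) 2^(-k).\<close>

lemma AE_convergent_of_rapid:
  assumes G: "\<And>k. G k \<in> Lp p" and p: "0 < p"
    and rapid: "\<And>k. Lp_int p (\<lambda>x. G (Suc k) x - G k x) \<le> (1/2) ^ k * (1/2) powr (p * real k)"
  shows "AE x in lebesgue. convergent (\<lambda>k. G k x)"
proof -
  note [measurable] = Lp_measurable[OF G]
  define D where "D = (\<lambda>k x. 2 powr (p * real k) * \<bar>G (Suc k) x - G k x\<bar> powr p)"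
  have [measurable]: "D k \<in> borel_measurable lebesgue" for k unfolding D_def by measurable
  have D0: "0 \<le> D k x" for k x by (simp add: D_def)
  have Di: "integrable lebesgue (D k)" for k
    unfolding D_def using Lp_integrable[OF Lp_diff(1)[OF _ G G]] p by simp
  have DI: "(LINT x|lebesgue. D k x) \<le> (1/2) ^ k" for k
  proof -
    have "(LINT x|lebesgue. D k x) = 2 powr (p * real k) * Lp_int p (\<lambda>x. G (Suc k) x - G k x)"
      by (simp add: D_def Lp_int_def)
    also have "\<dots> \<le> 2 powr (p * real k) * ((1/2) ^ k * (1/2) powr (p * real k))"
      by (intro mult_left_mono rapid) simp
    also have "\<dots> = (1/2) ^ k" by (simp add: powr_divide)
    finally show ?thesis .
  qed
  have "(\<integral>\<^sup>+x. (\<Sum>k. ennreal (D k x)) \<partial>lebesgue) = (\<Sum>k. \<integral>\<^sup>+x. ennreal (D k x) \<partial>lebesgue)"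
    by (rule nn_integral_suminf) measurable
  also have "\<dots> \<le> (\<Sum>k. ennreal ((1/2) ^ k))"
    using D0 DI Di by (intro suminf_le) (auto simp: nn_integral_eq_integral)
  also have "\<dots> = ennreal (\<Sum>k. (1/2) ^ k)"
    by (intro suminf_ennreal2) auto
  finally have "(\<integral>\<^sup>+x. (\<Sum>k. ennreal (D k x)) \<partial>lebesgue) \<noteq> \<infinity>"
    by (auto simp: top_unique)
  then have "AE x in lebesgue. (\<Sum>k. ennreal (D k x)) \<noteq> \<infinity>"
    by (intro nn_integral_noteq_infinite) measurable
  then show ?thesis
  proof eventually_elim
    case (elim x)
    then obtain M where M: "(\<Sum>k. ennreal (D k x)) = ennreal M" "0 \<le> M"
      by (cases "(\<Sum>k. ennreal (D k x))") auto
    have DM: "D k x \<le> M" for k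
    proof -
      have "ennreal (D k x) = (\<Sum>i\<in>{k}. ennreal (D i x))" by simp
      also have "\<dots> \<le> ennreal M" unfolding M(1)[symmetric] by (intro sum_le_suminf) auto
      finally show ?thesis using M by simp
    qed
    have bd: "\<bar>G (Suc k) x - G k x\<bar> \<le> M powr (1/p) * (1/2) ^ k" for k
    proof -
      have "\<bar>G (Suc k) x - G k x\<bar> = (1/2) ^ k * (D k x) powr (1/p)"
        using p by (simp add: D_def powr_mult powr_powr powr_realpow power_divide)
      also have "\<dots> \<le> (1/2) ^ k * M powr (1/p)"
        using DM D0 p by (intro mult_left_mono powr_mono2) auto
      finally show ?thesis by (simp add: mult.commute)
    qed
    have "summable (\<lambda>k. G (Suc k) x - G k x)"
      by (rule summable_comparison_test[of _ "\<lambda>k. M powr (1/p) * (1/2) ^ k"]) (use bd in auto)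
    then have "convergent (\<lambda>n. \<Sum>k<n. G (Suc k) x - G k x)"
      by (simp add: summable_iff_convergent)
    then have "convergent (\<lambda>n. G n x - G 0 x)" 
      using sum_lessThan_telescope[of "\<lambda>k. G k x"] by simp
    then have "convergent (\<lambda>n. (G n x - G 0 x) + G 0 x)"
      by (intro convergent_add convergent_const)
    then show ?case by simp
  qed
qed

text \<open>Riesz-Fischer: a rapidly Cauchy subsequence converges almost everywhere, and Fatou's
  lemma upgrades this to convergence of the whole sequence in L_p.\<close>

theorem Lp_complete:
  assumes G: "\<And>k. G k \<in> Lp p" and p: "0 < p"
    and Cauchy: "\<And>e. 0 < e \<Longrightarrow> \<exists>N. \<forall>m\<ge>N. \<forall>n\<ge>N. Lp_int p (\<lambda>x. G m x - G n x) < e"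
  shows "\<exists>g\<in>Lp p. (\<lambda>n. Lp_int p (\<lambda>x. g x - G n x)) \<longlonglongrightarrow> 0"
proof -
  define \<epsilon> where "\<epsilon> = (\<lambda>k::nat. (1/2) ^ k * (1/2) powr (p * real k))"
  have \<epsilon>: "0 < \<epsilon> k" for k by (simp add: \<epsilon>_def)
  obtain N where N: "\<And>k m n. m \<ge> N k \<Longrightarrow> n \<ge> N k \<Longrightarrow> Lp_int p (\<lambda>x. G m x - G n x) < \<epsilon> k"
    using Cauchy[OF \<epsilon>] by metis
  \<comment> \<open>The maximum makes both \<open>\<phi> k\<close> and \<open>\<phi> (Suc k)\<close>
    exceed \<open>N k\<close>, as the rapid estimate requires; the summand k forces the subsequence
    to infinity.\<close>
  define \<phi> where "\<phi> = (\<lambda>k. Max (N ` {..k}) + k)"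
  have \<phi>N: "N j \<le> \<phi> k" if "j \<le> k" for j k
    using that by (auto simp: \<phi>_def intro!: trans_le_add1 Max_ge)
  have \<phi>k: "k \<le> \<phi> k" for k by (simp add: \<phi>_def)
  have "AE x in lebesgue. convergent (\<lambda>k. G (\<phi> k) x)"
    using \<phi>N p by (intro AE_convergent_of_rapid[where p = p] G less_imp_le[OF N[unfolded \<epsilon>_def]]) auto
  then have lim: "AE x in lebesgue. (\<lambda>k. G (\<phi> k) x) \<longlonglongrightarrow> lim (\<lambda>k. G (\<phi> k) x)"
    by eventually_elim (simp add: convergent_LIMSEQ_iff)
  define g where "g = (\<lambda>x. lim (\<lambda>k. G (\<phi> k) x))"
  note [measurable] = Lp_measurable[OF G]
  have g[measurable]: "g \<in> borel_measurable lebesgue" unfolding g_def by measurable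
  \<comment> \<open>With n fixed, the other index runs to infinity along the subsequence, and Fatou
    carries the Cauchy bound over to g.\<close>
  have *: "(\<lambda>x. g x - G n x) \<in> Lp p \<and> Lp_int p (\<lambda>x. g x - G n x) \<le> e"
    if N': "\<forall>m\<ge>N'. \<forall>n\<ge>N'. Lp_int p (\<lambda>x. G m x - G n x) < e" and n: "n \<ge> N'" for e n N'
  proof -
    have "AE x in lebesgue. (\<lambda>k. G (\<phi> (k + N')) x - G n x) \<longlonglongrightarrow> g x - G n x"
      using lim
    proof eventually_elim
      case (elim x)
      then have "(\<lambda>k. G (\<phi> (k + N')) x) \<longlonglongrightarrow> g x"
        unfolding g_def by (rule LIMSEQ_ignore_initial_segment)
      then show ?case by (intro tendsto_diff tendsto_const)
    qed
    moreover have "Lp_int p (\<lambda>x. G (\<phi> (k + N')) x - G n x) \<le> e" for k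
      using N' n \<phi>k[of "k + N'"] by (intro less_imp_le) auto
    ultimately show ?thesis
      using Lp_int_le_liminf[of "\<lambda>x. g x - G n x" "\<lambda>k x. G (\<phi> (k + N')) x - G n x" p e]
        Lp_diff(1)[OF _ G G] p by auto
  qed
  obtain N1 where N1: "\<forall>m\<ge>N1. \<forall>n\<ge>N1. Lp_int p (\<lambda>x. G m x - G n x) < 1" using Cauchy[of 1] by auto
  have "(\<lambda>x. (g x - G N1 x) + G N1 x) \<in> Lp p"
    using *[OF N1, of N1] p G by (intro Lp_add) auto
  then have "g \<in> Lp p" by simp
  moreover have "(\<lambda>n. Lp_int p (\<lambda>x. g x - G n x)) \<longlonglongrightarrow> 0"
  proof (rule LIMSEQ_I)
    fix r :: real assume r: "0 < r"
    then obtain N' where N': "\<forall>m\<ge>N'. \<forall>n\<ge>N'. Lp_int p (\<lambda>x. G m x - G n x) < r / 2"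
      using Cauchy[of "r / 2"] by auto
    then have "norm (Lp_int p (\<lambda>x. g x - G n x) - 0) < r" if "n \<ge> N'" for n
      using *[OF N' that] r by auto
    then show "\<exists>no. \<forall>n\<ge>no. norm (Lp_int p (\<lambda>x. g x - G n x) - 0) < r" by blast
  qed
  ultimately show ?thesis by blast
qed

section \<open>Dyadic intervals, Rademacher functions and the square function on the unit
  interval\<close>

definition dyadic_idx :: "nat \<Rightarrow> real \<Rightarrow> nat" where
  "dyadic_idx n t = nat \<lfloor>2 ^ n * t\<rfloor>"

definition dyadic_ivl :: "nat \<Rightarrow> nat \<Rightarrow> real set" where
  "dyadic_ivl n j = {real j / 2 ^ n ..< (real j + 1) / 2 ^ n}"

text \<open>The conjunct \<open>0 \<le> t\<close> is essential: \<open>nat\<close> truncates, so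
  every negative t has index 0 as well.\<close>

lemma dyadic_ivl_iff: "t \<in> dyadic_ivl n j \<longleftrightarrow> 0 \<le> t \<and> dyadic_idx n t = j"
proof -
  have "t \<in> dyadic_ivl n j \<longleftrightarrow> real j \<le> 2 ^ n * t \<and> 2 ^ n * t < real j + 1"
    by (simp add: dyadic_ivl_def field_simps)
  also have "\<dots> \<longleftrightarrow> \<lfloor>2 ^ n * t\<rfloor> = int j" by (simp add: floor_eq_iff)
  also have "\<dots> \<longleftrightarrow> 0 \<le> 2 ^ n * t \<and> nat \<lfloor>2 ^ n * t\<rfloor> = j"
    by (metis int_nat_eq nat_int of_nat_0_le_iff zero_le_floor)
  also have "0 \<le> 2 ^ n * t \<longleftrightarrow> 0 \<le> t"
    using mult_le_cancel_left_pos[of "2 ^ n" 0 t] by simp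
  finally show ?thesis by (simp add: dyadic_idx_def)
qed

lemma dyadic_idx_Suc_div: "dyadic_idx (Suc n) t div 2 = dyadic_idx n t"
proof -
  have "\<lfloor>2 ^ n * t\<rfloor> = \<lfloor>2 ^ Suc n * t\<rfloor> div 2"
    using floor_divide_real_eq_div[of 2 "2 ^ Suc n * t"] by simp
  then show ?thesis by (simp add: dyadic_idx_def nat_div_distrib')
qed

lemma dyadic_idx_less: "t < 1 \<Longrightarrow> dyadic_idx n t < 2 ^ n"
  by (simp add: dyadic_idx_def nat_less_iff floor_less_iff)

lemma dyadic_idx_0: "t < 1 \<Longrightarrow> dyadic_idx 0 t = 0"
  using dyadic_idx_less[of t 0] by simp

lemma measurable_dyadic_idx [measurable]: "dyadic_idx n \<in> lebesgue \<rightarrow>\<^sub>M count_space UNIV"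
proof -
  have "dyadic_idx n \<in> lborel \<rightarrow>\<^sub>M count_space UNIV" unfolding dyadic_idx_def by measurable
  then show ?thesis by (rule measurable_completion)
qed

lemma has_integral_dyadic_step:
  fixes g :: "nat \<Rightarrow> real"
  shows "set_integrable lebesgue {0..<1} (\<lambda>t. g (dyadic_idx n t))"
    and "(LINT t:{0..<1}|lebesgue. g (dyadic_idx n t)) = (\<Sum>j<2 ^ n. g j) / 2 ^ n"
proof -
  have eq: "indicator {0..<1} t *\<^sub>R g (dyadic_idx n t) = (\<Sum>j<2 ^ n. g j * indicator (dyadic_ivl n j) t)" for t
  proof (cases "t \<in> {0..<1}")
    case True
    have "(\<Sum>j<2 ^ n. g j * indicator (dyadic_ivl n j) t) = (\<Sum>j<2 ^ n. if j = dyadic_idx n t then g j else 0)"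
      using True by (intro sum.cong) (auto simp: indicator_def dyadic_ivl_iff)
    then show ?thesis using True by (simp add: dyadic_idx_less)
  next
    case False
    have "indicator (dyadic_ivl n j) t = (0::real)" if "j < 2 ^ n" for j
    proof -
      have "(real j + 1) / 2 ^ n \<le> 1"
        using that by (simp add: field_simps) (metis Suc_leI of_nat_Suc of_nat_le_numeral_power_cancel_iff)
      moreover have "0 \<le> real j / 2 ^ n" by simp
      ultimately have "t \<notin> dyadic_ivl n j"
        using False unfolding dyadic_ivl_def atLeastLessThan_iff by linarith
      then show ?thesis by simp
    qed
    then show ?thesis using False by simp
  qed
  have *: "has_bochner_integral lebesgue (\<lambda>t. g j * indicator (dyadic_ivl n j) t) (g j * (1 / 2 ^ n))" for j
  proof -
    have "has_bochner_integral lebesgue (indicator (dyadic_ivl n j)) (measure lebesgue (dyadic_ivl n j))"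
      by (rule has_bochner_integral_real_indicator) (auto simp: dyadic_ivl_def divide_right_mono)
    moreover have "measure lebesgue (dyadic_ivl n j) = 1 / 2 ^ n"
      by (simp add: dyadic_ivl_def divide_right_mono field_simps)
    ultimately show ?thesis by (metis has_bochner_integral_mult_right)
  qed
  have "has_bochner_integral lebesgue (\<lambda>t. \<Sum>j<2 ^ n. g j * indicator (dyadic_ivl n j) t) (\<Sum>j<2 ^ n. g j * (1 / 2 ^ n))"
    by (intro has_bochner_integral_sum *)
  then have "has_bochner_integral lebesgue (\<lambda>t. indicator {0..<1} t *\<^sub>R g (dyadic_idx n t)) ((\<Sum>j<2 ^ n. g j) / 2 ^ n)"
    by (simp only: eq sum_divide_distrib) simp
  then show "set_integrable lebesgue {0..<1} (\<lambda>t. g (dyadic_idx n t))"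
    and "(LINT t:{0..<1}|lebesgue. g (dyadic_idx n t)) = (\<Sum>j<2 ^ n. g j) / 2 ^ n"
    by (auto simp: has_bochner_integral_iff set_integrable_def set_lebesgue_integral_def)
qed

text \<open>The n-th Rademacher function: the parity of the index at level n + 1 is the binary digit
  number n + 1, which separates the two halves of an interval of level n.\<close>

definition rad :: "nat \<Rightarrow> real \<Rightarrow> real" where
  "rad n t = (-1) ^ dyadic_idx (Suc n) t"

lemma abs_rad [simp]: "\<bar>rad n t\<bar> = 1"
  by (simp add: rad_def power_abs)

lemma dyadic_mart_idx:
  "dyadic_mart a W n (dyadic_idx n t) = a + (\<Sum>i<n. rad i t * W i (dyadic_idx i t))"
  by (induction n) (simp_all add: dyadic_idx_Suc_div rad_def)

lemma dyadic_sq_idx: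
  "dyadic_sq a W n (dyadic_idx n t) = a\<^sup>2 + (\<Sum>i<n. (W i (dyadic_idx i t))\<^sup>2)"
  by (induction n) (simp_all add: dyadic_idx_Suc_div)

definition mart_int :: "real \<Rightarrow> real \<Rightarrow> (nat \<Rightarrow> nat \<Rightarrow> real) \<Rightarrow> nat \<Rightarrow> real" where
  "mart_int p a W n =
    (LINT t:{0..<1}|lebesgue. \<bar>a + (\<Sum>i<n. rad i t * W i (dyadic_idx i t))\<bar> powr p)"

definition sq_int :: "real \<Rightarrow> real \<Rightarrow> (nat \<Rightarrow> nat \<Rightarrow> real) \<Rightarrow> nat \<Rightarrow> real" where
  "sq_int p a W n =
    (LINT t:{0..<1}|lebesgue. (a\<^sup>2 + (\<Sum>i<n. (W i (dyadic_idx i t))\<^sup>2)) powr (p / 2))"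

lemma mart_int_sum: "mart_int p a W n = (\<Sum>j<2 ^ n. \<bar>dyadic_mart a W n j\<bar> powr p) / 2 ^ n"
  unfolding mart_int_def dyadic_mart_idx[symmetric] by (rule has_integral_dyadic_step)

lemma sq_int_sum: "sq_int p a W n = (\<Sum>j<2 ^ n. dyadic_sq a W n j powr (p / 2)) / 2 ^ n"
  unfolding sq_int_def dyadic_sq_idx[symmetric] by (rule has_integral_dyadic_step)

lemma sq_int_integrable:
  fixes p :: real
  shows "set_integrable lebesgue {0..<1} (\<lambda>t. (a\<^sup>2 + (\<Sum>i<n. (W i (dyadic_idx i t))\<^sup>2)) powr (p / 2))"
  unfolding dyadic_sq_idx[symmetric] by (rule has_integral_dyadic_step)

lemma mart_int_integrable:
  fixes p :: real
  shows "set_integrable lebesgue {0..<1} (\<lambda>t. \<bar>a + (\<Sum>i<n. rad i t * W i (dyadic_idx i t))\<bar> powr p)"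
  unfolding dyadic_mart_idx[symmetric] by (rule has_integral_dyadic_step)

text \<open>One constant serves all lengths n and all predictable sequences \<open>W\<close>. This
  allows the inequality to be applied to arbitrary finite sets of translates and to tails of a
  martingale.\<close>

theorem square_function:
  assumes "4 < p"
  shows "\<exists>C>0. \<forall>a W n. mart_int p a W n \<le> C * sq_int p a W n \<and> sq_int p a W n \<le> C * mart_int p a W n"
proof -
  obtain C1 where C1: "C1 > 0" "\<And>a W n. (\<Sum>j<2 ^ n. \<bar>dyadic_mart a W n j\<bar> powr p)
      \<le> C1 * (\<Sum>j<2 ^ n. dyadic_sq a W n j powr (p / 2))"
    using dyadic_mart_le_sq[of p] assms by auto
  obtain C2 where C2: "C2 > 0" "\<And>a W n. (\<Sum>j<2 ^ n. dyadic_sq a W n j powr (p / 2))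
      \<le> C2 * (\<Sum>j<2 ^ n. \<bar>dyadic_mart a W n j\<bar> powr p)"
    using dyadic_sq_le_mart[OF assms] by auto
  define C where "C = max C1 C2"
  have "mart_int p a W n \<le> C * sq_int p a W n" for a W n
  proof -
    have "mart_int p a W n \<le> C1 * sq_int p a W n"
      using C1(2)[where a = a and W = W and n = n] unfolding mart_int_sum sq_int_sum by (simp add: divide_right_mono)
    also have "\<dots> \<le> C * sq_int p a W n"
      unfolding sq_int_sum C_def by (intro mult_right_mono divide_nonneg_pos sum_nonneg) auto
    finally show ?thesis .
  qed
  moreover have "sq_int p a W n \<le> C * mart_int p a W n" for a W n
  proof -
    have "sq_int p a W n \<le> C2 * mart_int p a W n"
      using C2(2)[where a = a and W = W and n = n] unfolding mart_int_sum sq_int_sum by (simp add: divide_right_mono)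
    also have "\<dots> \<le> C * mart_int p a W n"
      unfolding mart_int_sum C_def by (intro mult_right_mono divide_nonneg_pos sum_nonneg) auto
    finally show ?thesis .
  qed
  moreover have "C > 0" using C1 by (simp add: C_def)
  ultimately show ?thesis by blast
qed

subsection \<open>Unconditionality from boundedness of projections\<close>

lemma lin_comb_diff: "lin_comb f F (\<lambda>l. a l - b l) = (\<lambda>x. lin_comb f F a x - lin_comb f F b x)"
  by (simp add: lin_comb_def left_diff_distrib sum_subtractf)

lemma lin_comb_restrict:
  assumes "finite G" "F \<subseteq> G"
  shows "lin_comb f G (\<lambda>l. if l \<in> F then a l else 0) = lin_comb f F a"
proof -
  have "(\<Sum>l\<in>G. (if l \<in> F then a l else 0) * translate f (real_of_int l) x)
      = (\<Sum>l\<in>F. a l * translate f (real_of_int l) x)" for x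
    using assms by (intro sum.mono_neutral_cong_right) auto
  then show ?thesis by (simp add: lin_comb_def)
qed

lemma lin_comb_singleton_int:
  "f \<in> Lp p \<Longrightarrow> Lp_int p (lin_comb f {l} a) = \<bar>a l\<bar> powr p * Lp_int p f"
  by (simp add: lin_comb_def Lp_scale(2) translate_Lp)

text \<open>Uniformly bounded coordinate projections suffice. Singletons F bound the individual
  coefficients, so those of approximants of g form Cauchy sequences; the limits expand g because the
  projection bound survives the passage to the limit. The same coefficient bound gives
  uniqueness.\<close>

lemma unconditional_basicI:
  assumes p: "0 < p" and f: "f \<in> Lp p" "0 < Lp_int p f" and K0: "0 < K"
    and K: "\<And>F G a. finite G \<Longrightarrow> F \<subseteq> G \<Longrightarrow> G \<subseteq> \<Lambda> \<Longrightarrow>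
      Lp_int p (lin_comb f F a) \<le> K * Lp_int p (lin_comb f G a)"
  shows "unconditional_basic p f \<Lambda>"
  unfolding unconditional_basic_def
proof (intro conjI ballI)
  show "translate f (real_of_int l) \<in> Lp p" for l by (intro translate_Lp f)
next
  fix g assume g: "g \<in> Xp p f \<Lambda>"
  note LC = lin_comb_Lp[OF less_imp_le[OF p] f(1)]
  have gL: "g \<in> Lp p" using g by (simp add: Xp_def)
  have coeff: "\<bar>a l\<bar> powr p * Lp_int p f \<le> K * Lp_int p (lin_comb f G a)"
    if "finite G" "G \<subseteq> \<Lambda>" "l \<in> G" for G a l
    using K[of G "{l}" a] that f by (simp add: lin_comb_singleton_int)
  show "\<exists>!a. (\<forall>l. l \<notin> \<Lambda> \<longrightarrow> a l = 0) \<and> uncond_expansion p f \<Lambda> a g"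
  proof (rule ex_ex1I)
    define \<delta> where "\<delta> = (\<lambda>n::nat. inverse (real (Suc n)))"
    have \<delta>: "0 < \<delta> n" for n by (simp add: \<delta>_def)
    have \<delta>mono: "\<delta> n \<le> \<delta> m" if "m \<le> n" for m n using that by (simp add: \<delta>_def divide_simps)
    have \<delta>lim: "\<delta> \<longlonglongrightarrow> 0" unfolding \<delta>_def by (rule LIMSEQ_inverse_real_of_nat)
    have "\<exists>F a. finite F \<and> F \<subseteq> \<Lambda> \<and> Lp_int p (\<lambda>x. g x - lin_comb f F a x) < \<delta> n" for n
    proof -
      have "0 < \<delta> n powr (1/p)" using \<delta>[of n] by simp
      then obtain F a where "finite F" "F \<subseteq> \<Lambda>" "Lp_norm p (\<lambda>x. g x - lin_comb f F a x) < \<delta> n powr (1/p)"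
        using g unfolding Xp_def by blast
      moreover have "(\<delta> n powr (1/p)) powr p = \<delta> n" using \<delta>[of n] p by (simp add: powr_powr)
      ultimately show ?thesis using p \<delta>[of n] by (auto simp: Lp_norm_less_iff)
    qed
    then obtain F a where F: "\<And>n. finite (F n)" "\<And>n. F n \<subseteq> \<Lambda>"
      and Fa: "\<And>n. Lp_int p (\<lambda>x. g x - lin_comb f (F n) (a n) x) < \<delta> n"
      by metis
    \<comment> \<open>Extending coefficients by zero lets approximants with different supports be
      compared over one common finite set.\<close>
    define b where "b = (\<lambda>n l. if l \<in> F n then a n l else 0)"
    define v where "v = (\<lambda>n. lin_comb f (F n) (a n))"
    have vL: "v n \<in> Lp p" for n unfolding v_def by (rule LC)
    have gv: "Lp_int p (\<lambda>x. g x - v n x) < \<delta> n" for n using Fa by (simp add: v_def)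
    have bG: "lin_comb f G (b n) = v n" if "finite G" "F n \<subseteq> G" for n G
      unfolding b_def v_def by (rule lin_comb_restrict[OF that])
    define E where "E = (\<lambda>m. 2 powr p * (\<delta> m + \<delta> m))"
    have vv: "Lp_int p (\<lambda>x. v n x - v m x) \<le> E M" if "M \<le> n" "M \<le> m" for M m n
    proof -
      have "Lp_int p (\<lambda>x. v n x - v m x) \<le> 2 powr p * (Lp_int p (\<lambda>x. v n x - g x) + Lp_int p (\<lambda>x. g x - v m x))"
        using p by (intro Lp_int_triangle vL gL) auto
      also have "\<dots> \<le> E M"
        unfolding E_def using gv[of n] gv[of m] \<delta>mono[OF that(1)] \<delta>mono[OF that(2)] Lp_int_minus_commute[of p g "v n"]
        by (intro mult_left_mono add_mono) auto
      finally show ?thesis .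
    qed
    have "convergent (\<lambda>n. b n l)" if l: "l \<in> \<Lambda>" for l
    proof -
      have "Cauchy (\<lambda>n. b n l)"
      proof (rule CauchyI)
        fix e :: real assume e: "0 < e"
        then have "0 < e powr p * Lp_int p f / K" using f K0 by simp
        moreover have "E \<longlonglongrightarrow> 0" using tendsto_mult_right_zero[OF tendsto_add_zero[OF \<delta>lim \<delta>lim]]
          unfolding E_def .
        ultimately obtain M where M: "E M < e powr p * Lp_int p f / K"
          using order_tendstoD(2)[of E 0 sequentially] eventually_sequentially by fastforce
        have "norm (b m l - b n l) < e" if mn: "m \<ge> M" "n \<ge> M" for m n
        proof -
          let ?G = "insert l (F m \<union> F n)"
          have "\<bar>b m l - b n l\<bar> powr p * Lp_int p f \<le> K * Lp_int p (lin_comb f ?G (\<lambda>l. b m l - b n l))"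
            using F l by (intro coeff) auto
          also have "lin_comb f ?G (\<lambda>l. b m l - b n l) = (\<lambda>x. v m x - v n x)"
          proof -
            have "lin_comb f ?G (b m) = v m" "lin_comb f ?G (b n) = v n"
              using F by (auto intro!: bG)
            then show ?thesis by (simp add: lin_comb_diff)
          qed
          also have "K * Lp_int p (\<lambda>x. v m x - v n x) \<le> K * E M"
            using K0 by (intro mult_left_mono vv mn) auto
          also have "\<dots> < e powr p * Lp_int p f" using M K0 by (simp add: field_simps)
          finally have "\<bar>b m l - b n l\<bar> powr p < e powr p" using f by simp
          then show ?thesis using e p powr_mono2[of p e "\<bar>b m l - b n l\<bar>"] by force
        qed
        then show "\<exists>M. \<forall>m\<ge>M. \<forall>n\<ge>M. norm (b m l - b n l) < e" by blast
      qed
      then show ?thesis by (simp add: Cauchy_convergent_iff)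
    qed
    then obtain a0 where a0: "\<And>l. l \<in> \<Lambda> \<Longrightarrow> (\<lambda>n. b n l) \<longlonglongrightarrow> a0 l"
      unfolding convergent_def by metis
    define \<alpha> where "\<alpha> = (\<lambda>l. if l \<in> \<Lambda> then a0 l else 0)"
    have \<alpha>: "(\<lambda>n. b n l) \<longlonglongrightarrow> \<alpha> l" if "l \<in> \<Lambda>" for l using a0[OF that] that by (simp add: \<alpha>_def)
    \<comment> \<open>For an arbitrary finite G the difference of two approximants restricted to G
      is controlled by projecting from a set that contains both supports. Over the finite G
      coefficientwise limits are pointwise limits, so Fatou applies, uniformly in G.\<close>
    have bnd: "Lp_int p (\<lambda>x. lin_comb f G \<alpha> x - lin_comb f G (b m) x) \<le> K * E m"
      if G: "finite G" "G \<subseteq> \<Lambda>" for G m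
    proof (rule Lp_int_le_liminf(2)[where G = "\<lambda>k x. lin_comb f G (b (k + m)) x - lin_comb f G (b m) x"])
      show "(\<lambda>x. lin_comb f G \<alpha> x - lin_comb f G (b m) x) \<in> borel_measurable lebesgue"
        by (intro borel_measurable_diff Lp_measurable[OF LC])
      show "(\<lambda>x. lin_comb f G (b (k + m)) x - lin_comb f G (b m) x) \<in> Lp p" for k
        using p by (intro Lp_diff(1) LC) auto
      have "(\<lambda>k. lin_comb f G (b (k + m)) x - lin_comb f G (b m) x) \<longlonglongrightarrow> lin_comb f G \<alpha> x - lin_comb f G (b m) x" for x
        unfolding lin_comb_def using G \<alpha>
        by (intro tendsto_diff tendsto_sum tendsto_mult tendsto_const LIMSEQ_ignore_initial_segment[where k = m]) auto
      then show "AE x in lebesgue. (\<lambda>k. lin_comb f G (b (k + m)) x - lin_comb f G (b m) x)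
          \<longlonglongrightarrow> lin_comb f G \<alpha> x - lin_comb f G (b m) x" by simp
      show "Lp_int p (\<lambda>x. lin_comb f G (b (k + m)) x - lin_comb f G (b m) x) \<le> K * E m" for k
      proof -
        let ?G = "G \<union> F (k + m) \<union> F m"
        have "Lp_int p (lin_comb f G (\<lambda>l. b (k + m) l - b m l)) \<le> K * Lp_int p (lin_comb f ?G (\<lambda>l. b (k + m) l - b m l))"
          using G F by (intro K) auto
        also have "lin_comb f ?G (\<lambda>l. b (k + m) l - b m l) = (\<lambda>x. v (k + m) x - v m x)"
        proof -
          have "lin_comb f ?G (b (k + m)) = v (k + m)" "lin_comb f ?G (b m) = v m"
            using F G by (auto intro!: bG)
          then show ?thesis by (simp add: lin_comb_diff)
        qed
        also have "K * Lp_int p (\<lambda>x. v (k + m) x - v m x) \<le> K * E m"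
          using K0 by (intro mult_left_mono vv) auto
        finally show ?thesis by (simp add: lin_comb_diff)
      qed
    qed (rule p)
    have "uncond_expansion p f \<Lambda> \<alpha> g"
      unfolding uncond_expansion_def
    proof (intro allI impI)
      fix e :: real assume e: "0 < e"
      have "(\<lambda>m. 2 powr p * (\<delta> m + K * E m)) \<longlonglongrightarrow> 2 powr p * (0 + K * (2 powr p * (0 + 0)))"
        unfolding E_def by (intro tendsto_intros \<delta>lim)
      then have "(\<lambda>m. 2 powr p * (\<delta> m + K * E m)) \<longlonglongrightarrow> 0" by simp
      from order_tendstoD(2)[OF this, of "e powr p"] e
      obtain m where m: "2 powr p * (\<delta> m + K * E m) < e powr p"
        using eventually_sequentially by fastforce
      have "Lp_norm p (\<lambda>x. g x - lin_comb f G \<alpha> x) < e" if G: "finite G" "F m \<subseteq> G" "G \<subseteq> \<Lambda>" for G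
      proof -
        have "Lp_int p (\<lambda>x. g x - lin_comb f G \<alpha> x)
            \<le> 2 powr p * (Lp_int p (\<lambda>x. g x - v m x) + Lp_int p (\<lambda>x. v m x - lin_comb f G \<alpha> x))"
          using p by (intro Lp_int_triangle vL gL LC) auto
        also have "\<dots> \<le> 2 powr p * (\<delta> m + K * E m)"
          using bnd[OF G(1,3), of m] gv[of m] unfolding bG[OF G(1,2)]
          by (intro mult_left_mono add_mono) (auto simp: Lp_int_minus_commute[of p "v m"])
        also note m
        finally show ?thesis using p e by (simp add: Lp_norm_less_iff)
      qed
      then show "\<exists>F0. finite F0 \<and> F0 \<subseteq> \<Lambda> \<and>
          (\<forall>G. finite G \<and> F0 \<subseteq> G \<and> G \<subseteq> \<Lambda> \<longrightarrow> Lp_norm p (\<lambda>x. g x - lin_comb f G \<alpha> x) < e)"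
        using F by (intro exI[of _ "F m"]) simp
    qed
    then show "\<exists>a. (\<forall>l. l \<notin> \<Lambda> \<longrightarrow> a l = 0) \<and> uncond_expansion p f \<Lambda> a g"
      by (intro exI[of _ \<alpha>]) (simp add: \<alpha>_def)
  next
    fix a b
    assume a: "(\<forall>l. l \<notin> \<Lambda> \<longrightarrow> a l = 0) \<and> uncond_expansion p f \<Lambda> a g"
      and b: "(\<forall>l. l \<notin> \<Lambda> \<longrightarrow> b l = 0) \<and> uncond_expansion p f \<Lambda> b g"
    show "a = b"
    proof (rule ext, rule ccontr)
      fix l assume ne: "a l \<noteq> b l"
      then have l: "l \<in> \<Lambda>" using a b by metis
      \<comment> \<open>Chosen so that the coefficient bound, with two errors below
        \<open>\<eta>\<close>, returns the left side itself with strict inequality.\<close>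
      define \<eta> where "\<eta> = \<bar>a l - b l\<bar> powr p * Lp_int p f / (K * (2 powr p * 2))"
      have \<eta>: "0 < \<eta>" using ne f K0 by (simp add: \<eta>_def)
      define e where "e = \<eta> powr (1 / p)"
      have e: "0 < e" "e powr p = \<eta>" using \<eta> p by (simp_all add: e_def powr_powr)
      from a obtain A where "finite A \<and> A \<subseteq> \<Lambda> \<and> (\<forall>G. finite G \<and> A \<subseteq> G \<and> G \<subseteq> \<Lambda> \<longrightarrow>
          Lp_norm p (\<lambda>x. g x - lin_comb f G a x) < e)"
        unfolding uncond_expansion_def using e(1) by meson
      then have A: "finite A" "A \<subseteq> \<Lambda>"
        "\<And>G. finite G \<Longrightarrow> A \<subseteq> G \<Longrightarrow> G \<subseteq> \<Lambda> \<Longrightarrow> Lp_norm p (\<lambda>x. g x - lin_comb f G a x) < e"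
        by simp_all
      from b obtain B where "finite B \<and> B \<subseteq> \<Lambda> \<and> (\<forall>G. finite G \<and> B \<subseteq> G \<and> G \<subseteq> \<Lambda> \<longrightarrow>
          Lp_norm p (\<lambda>x. g x - lin_comb f G b x) < e)"
        unfolding uncond_expansion_def using e(1) by meson
      then have B: "finite B" "B \<subseteq> \<Lambda>"
        "\<And>G. finite G \<Longrightarrow> B \<subseteq> G \<Longrightarrow> G \<subseteq> \<Lambda> \<Longrightarrow> Lp_norm p (\<lambda>x. g x - lin_comb f G b x) < e"
        by simp_all
      let ?G = "insert l (A \<union> B)"
      have 1: "Lp_int p (\<lambda>x. g x - lin_comb f ?G a x) < \<eta>" "Lp_int p (\<lambda>x. g x - lin_comb f ?G b x) < \<eta>"
        using A(3)[of ?G] B(3)[of ?G] A(1,2) B(1,2) l p e by (auto simp: Lp_norm_less_iff)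
      have "\<bar>a l - b l\<bar> powr p * Lp_int p f \<le> K * Lp_int p (lin_comb f ?G (\<lambda>l. a l - b l))"
        using A(1,2) B(1,2) l by (intro coeff) auto
      also have "\<dots> \<le> K * (2 powr p * (Lp_int p (\<lambda>x. lin_comb f ?G a x - g x) + Lp_int p (\<lambda>x. g x - lin_comb f ?G b x)))"
        unfolding lin_comb_diff using p K0 by (intro mult_left_mono Lp_int_triangle LC gL) auto
      also have "\<dots> < K * (2 powr p * (\<eta> + \<eta>))"
        using 1 K0 by (intro mult_strict_left_mono add_strict_mono) (auto simp: Lp_int_minus_commute[of p _ g])
      also have "\<dots> = \<bar>a l - b l\<bar> powr p * Lp_int p f" using K0 by (simp add: \<eta>_def)
      finally show False by simp
    qed
  qed
qed

subsection \<open>Translates along powers of three\<close>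

text \<open>If c < a, then 3^a is at least 3 * 3^c, which already exceeds 3^c + 3^d.\<close>

lemma pow3_sum_max:
  fixes a b c d :: nat
  assumes "(3::nat) ^ a + 3 ^ b = 3 ^ c + 3 ^ d" "b \<le> a" "d \<le> c"
  shows "a \<le> c"
proof (rule ccontr)
  assume "\<not> a \<le> c"
  then have "(3::nat) ^ Suc c \<le> 3 ^ a" by (intro power_increasing) auto
  moreover have "(3::nat) ^ d \<le> 3 ^ c" using assms by (intro power_increasing) auto
  moreover have "(0::nat) < 3 ^ c" "(0::nat) < 3 ^ b" by simp_all
  ultimately show False using assms(1) unfolding power_Suc by linarith
qed

lemma pow3_sum_unique_ordered:
  fixes a b c d :: nat
  assumes "(3::nat) ^ a + 3 ^ b = 3 ^ c + 3 ^ d" "b \<le> a" "d \<le> c"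
  shows "a = c \<and> b = d"
proof -
  have "a = c" using pow3_sum_max[OF assms] pow3_sum_max[OF assms(1)[symmetric] assms(3,2)] by simp
  then show ?thesis using assms(1) by simp
qed

text \<open>Moving the subtracted powers across gives two equal sums of two powers, hence the same
  unordered pair of exponents; i differs from j, so i must be k. The four rewritten equations cover
  the possible orderings.\<close>

lemma pow3_diff_unique:
  assumes eq: "(3::int) ^ i - 3 ^ j = 3 ^ k - 3 ^ l" and ne: "i \<noteq> j"
  shows "i = k"
proof -
  have "int (3 ^ i + 3 ^ l) = int (3 ^ k + 3 ^ j)" using eq by simp
  then have *: "(3::nat) ^ i + 3 ^ l = 3 ^ k + 3 ^ j" by (simp only: of_nat_eq_iff)
  have e: "(3::nat) ^ l + 3 ^ i = 3 ^ k + 3 ^ j" "(3::nat) ^ i + 3 ^ l = 3 ^ j + 3 ^ k"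
    "(3::nat) ^ l + 3 ^ i = 3 ^ j + 3 ^ k" using * by linarith+
  have "l \<le> i \<or> i \<le> l" "j \<le> k \<or> k \<le> j" by linarith+
  then show ?thesis
    using pow3_sum_unique_ordered[OF *] pow3_sum_unique_ordered[OF e(1)]
      pow3_sum_unique_ordered[OF e(2)] pow3_sum_unique_ordered[OF e(3)] ne by blast
qed

locale lacunary_sum =
  fixes p :: real and u :: "nat \<Rightarrow> real \<Rightarrow> real"
  assumes p: "0 < p"
    and supp: "\<And>i x. x \<notin> {0..<1} \<Longrightarrow> u i x = 0"
    and uLp: "\<And>i. u i \<in> Lp p"
    and summ: "summable (\<lambda>i. Lp_int p (u i))"
begin

text \<open>At each x at most one summand is nonzero, because \<open>x + 3 ^ i\<close> in [0,1)
  means that the floor of x is \<open>- (3 ^ i)\<close>; convergence of the series is never an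
  issue.\<close>

definition f :: "real \<Rightarrow> real" where
  "f x = (\<Sum>i. u i (x + 3 ^ i))"

lemma shift_floor:
  assumes "u i (x + 3 ^ i) \<noteq> 0"
  shows "\<lfloor>x\<rfloor> = - (3 ^ i)"
proof -
  have "x + 3 ^ i \<in> {0..<1}" using supp assms by blast
  then show ?thesis by (simp add: floor_eq_iff)
qed

lemma shift_zero: "\<lfloor>x\<rfloor> = - (3 ^ i) \<Longrightarrow> j \<noteq> i \<Longrightarrow> u j (x + 3 ^ j) = 0"
  using shift_floor[of j x] by fastforce

lemma f_eq:
  assumes "\<lfloor>x\<rfloor> = - (3 ^ i)"
  shows "f x = u i (x + 3 ^ i)"
  unfolding f_def using suminf_finite[of "{i}" "\<lambda>j. u j (x + 3 ^ j)"] shift_zero[OF assms] by simp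

lemma f_eq_0:
  assumes "\<And>i. \<lfloor>x\<rfloor> \<noteq> - (3 ^ i)"
  shows "f x = 0"
proof -
  have "u i (x + 3 ^ i) = 0" for i using assms shift_floor by blast
  then show ?thesis by (simp add: f_def)
qed

lemma f_powr_sums: "(\<lambda>i. \<bar>u i (x + 3 ^ i)\<bar> powr p) sums (\<bar>f x\<bar> powr p)"
proof (cases "\<exists>i. \<lfloor>x\<rfloor> = - (3 ^ i)")
  case True
  then obtain i where i: "\<lfloor>x\<rfloor> = - (3 ^ i)" by blast
  have "(\<lambda>i. \<bar>u i (x + 3 ^ i)\<bar> powr p) sums (\<Sum>i\<in>{i}. \<bar>u i (x + 3 ^ i)\<bar> powr p)"
  proof (rule sums_finite)
    fix j assume "j \<notin> {i}"
    then have "u j (x + 3 ^ j) = 0" by (intro shift_zero[OF i]) blast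
    then show "\<bar>u j (x + 3 ^ j)\<bar> powr p = 0" by simp
  qed simp
  then show ?thesis by (simp add: f_eq[OF i])
next
  case False
  have "f x = 0" using False by (intro f_eq_0) auto
  moreover have "u i (x + 3 ^ i) = 0" for i using False shift_floor by blast
  ultimately show ?thesis by simp
qed

lemma shift_Lp: "(\<lambda>x. u i (x + 3 ^ i)) \<in> Lp p" "Lp_int p (\<lambda>x. u i (x + 3 ^ i)) = Lp_int p (u i)"
  using translate_Lp[OF uLp, of i "- (3 ^ i)"] by (simp_all add: translate_def)

lemma f_Lp: "f \<in> Lp p"
proof (rule LpI)
  note [measurable] = Lp_measurable[OF shift_Lp(1)]
  show f[measurable]: "f \<in> borel_measurable lebesgue" unfolding f_def by measurable
  have "(\<integral>\<^sup>+x. ennreal (\<bar>f x\<bar> powr p) \<partial>lebesgue) = (\<integral>\<^sup>+x. (\<Sum>i. ennreal (\<bar>u i (x + 3 ^ i)\<bar> powr p)) \<partial>lebesgue)"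
    by (intro nn_integral_cong suminf_ennreal_eq[symmetric] f_powr_sums) simp
  also have "\<dots> = (\<Sum>i. \<integral>\<^sup>+x. ennreal (\<bar>u i (x + 3 ^ i)\<bar> powr p) \<partial>lebesgue)"
    by (intro nn_integral_suminf) measurable
  also have "\<dots> = (\<Sum>i. ennreal (Lp_int p (u i)))"
    using Lp_integrable[OF shift_Lp(1)] shift_Lp(2) by (simp add: nn_integral_eq_integral Lp_int_def)
  also have "\<dots> < \<infinity>" using summ by (simp add: suminf_ennreal2)
  finally show "integrable lebesgue (\<lambda>x. \<bar>f x\<bar> powr p)"
    by (intro integrableI_bounded) auto
qed

lemma f_center: "x \<in> {0..<1} \<Longrightarrow> f (x - 3 ^ i) = u i x"
  using f_eq[of "x - 3 ^ i" i] by (simp add: floor_eq_iff)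

text \<open>Two translates that are nonzero at x express its floor as 3^i - 3^j and as 3^k - 3^l.
  Off [0,1) this integer is not 0, so i differs from j and the difference determines i.\<close>

lemma f_outside:
  assumes x: "x \<notin> {0..<1}" and i: "f (x - 3 ^ i) \<noteq> 0" and k: "f (x - 3 ^ k) \<noteq> 0"
  shows "i = k"
proof -
  obtain j where j: "\<lfloor>x - 3 ^ i\<rfloor> = - (3 ^ j)" using f_eq_0 i by blast
  obtain l where l: "\<lfloor>x - 3 ^ k\<rfloor> = - (3 ^ l)" using f_eq_0 k by blast
  have f: "\<lfloor>x - 3 ^ n\<rfloor> = \<lfloor>x\<rfloor> - 3 ^ n" for n
    using floor_diff_of_int[of x "3 ^ n"] by simp
  have "\<lfloor>x\<rfloor> \<noteq> 0" using x by (auto simp: floor_eq_iff)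
  then show ?thesis using j l f[of i] f[of k] pow3_diff_unique[of i j k l] by force
qed

text \<open>The subtracted term \<open>\<bar>u i x\<bar> powr p\<close> merges two cases: on [0,1)
  it cancels the translate of f and leaves the first summand, elsewhere it is zero and at most one
  translate is active.\<close>

lemma norm_pointwise:
  assumes I: "finite I"
  shows "\<bar>\<Sum>i\<in>I. a i * f (x - 3 ^ i)\<bar> powr p
    = \<bar>\<Sum>i\<in>I. a i * u i x\<bar> powr p + (\<Sum>i\<in>I. \<bar>a i\<bar> powr p * (\<bar>f (x - 3 ^ i)\<bar> powr p - \<bar>u i x\<bar> powr p))"
proof (cases "x \<in> {0..<1}")
  case True
  then show ?thesis by (simp add: f_center)
next
  case False
  show ?thesis
  proof (cases "\<exists>i\<in>I. f (x - 3 ^ i) \<noteq> 0")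
    case True
    then obtain i where i: "i \<in> I" "f (x - 3 ^ i) \<noteq> 0" by blast
    have z: "f (x - 3 ^ j) = 0" if "j \<noteq> i" for j using f_outside[OF False i(2)] that by blast
    have "(\<Sum>i\<in>I. a i * f (x - 3 ^ i)) = a i * f (x - 3 ^ i)"
      using I i z by (subst sum.remove[of _ i]) (auto intro!: sum.neutral)
    moreover have "(\<Sum>i\<in>I. \<bar>a i\<bar> powr p * \<bar>f (x - 3 ^ i)\<bar> powr p) = \<bar>a i\<bar> powr p * \<bar>f (x - 3 ^ i)\<bar> powr p"
      using I i z by (subst sum.remove[of _ i]) (auto intro!: sum.neutral)
    ultimately show ?thesis using False by (simp add: supp abs_mult powr_mult)
  next
    case none: False
    then have "(\<Sum>i\<in>I. a i * f (x - 3 ^ i)) = 0"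
      "(\<Sum>i\<in>I. \<bar>a i\<bar> powr p * \<bar>f (x - 3 ^ i)\<bar> powr p) = 0"
      by (auto intro!: sum.neutral)
    then show ?thesis using False by (simp add: supp)
  qed
qed

lemma f_translate_Lp: "(\<lambda>x. f (x - 3 ^ i)) \<in> Lp p" "Lp_int p (\<lambda>x. f (x - 3 ^ i)) = Lp_int p f"
  using translate_Lp[OF f_Lp, of "3 ^ i"] by (simp_all add: translate_def)

lemma norm_formula:
  assumes I: "finite I"
  shows "Lp_int p (\<lambda>x. \<Sum>i\<in>I. a i * f (x - 3 ^ i))
    = Lp_int p (\<lambda>x. \<Sum>i\<in>I. a i * u i x) + (\<Sum>i\<in>I. \<bar>a i\<bar> powr p * (Lp_int p f - Lp_int p (u i)))"
proof -
  have "integrable lebesgue (\<lambda>x. \<bar>\<Sum>i\<in>I. a i * u i x\<bar> powr p)"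
    using p by (intro Lp_integrable[OF Lp_sum[OF _ Lp_scale(1)[OF uLp]]]) simp
  moreover have "integrable lebesgue (\<lambda>x. \<bar>f (x - 3 ^ i)\<bar> powr p)" for i
    by (rule Lp_integrable[OF f_translate_Lp(1)])
  moreover note Lp_integrable[OF uLp]
  ultimately show ?thesis
    unfolding Lp_int_def norm_pointwise[OF I]
    by (subst Bochner_Integration.integral_add)
      (simp_all flip: Lp_int_def add: f_translate_Lp(2))
qed

lemma u_le_f: "Lp_int p (u i) \<le> Lp_int p f"
proof -
  have "Lp_int p (u i) \<le> Lp_int p (\<lambda>x. f (x - 3 ^ i))"
    unfolding Lp_int_def
  proof (intro integral_mono Lp_integrable uLp f_translate_Lp)
    show "\<bar>u i x\<bar> powr p \<le> \<bar>f (x - 3 ^ i)\<bar> powr p" for x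
      by (cases "x \<in> {0..<1}") (simp_all add: supp f_center)
  qed
  then show ?thesis by (simp add: f_translate_Lp)
qed

end

subsection \<open>The Haar-type system\<close>

text \<open>The length of block k. The rate 4^(-k), and not merely a summable one, is needed in
  \<open>off_center_le\<close>, where a factor of up to 2^k has to be beaten.\<close>

definition block :: "real \<Rightarrow> nat \<Rightarrow> nat" where
  "block p k = (SOME N. 0 < N \<and> real N powr (1 - p / 4) \<le> (1 / 4) ^ k)"

lemma block_spec:
  assumes "4 < p"
  shows "0 < block p k" "real (block p k) powr (1 - p / 4) \<le> (1 / 4) ^ k"
proof -
  define \<delta> where "\<delta> = p / 4 - 1"
  have \<delta>: "0 < \<delta>" using assms by (simp add: \<delta>_def)
  obtain N :: nat where N: "(4 ^ k) powr (1 / \<delta>) \<le> real N" using real_arch_simple by blast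
  have N0: "0 < N"
  proof (rule ccontr)
    assume "\<not> 0 < N"
    then have "((4::real) ^ k) powr (1 / \<delta>) \<le> 0" using N by simp
    then show False by simp
  qed
  have "(4::real) ^ k = ((4 ^ k) powr (1 / \<delta>)) powr \<delta>" using \<delta> by (simp add: powr_powr)
  also have "\<dots> \<le> real N powr \<delta>" using N \<delta> by (intro powr_mono2) auto
  finally have "inverse (real N powr \<delta>) \<le> inverse (4 ^ k)" by (intro le_imp_inverse_le) auto
  then have "real N powr (- \<delta>) \<le> (1 / 4) ^ k" by (simp add: powr_minus power_one_over inverse_eq_divide)
  then have "\<exists>N. 0 < N \<and> real N powr (1 - p / 4) \<le> (1 / 4) ^ k"
    using N0 by (auto simp: \<delta>_def)
  from someI_ex[OF this] show "0 < block p k" "real (block p k) powr (1 - p / 4) \<le> (1 / 4) ^ k"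
    unfolding block_def by auto
qed

lemma dyadic_idx_div: "m \<le> n \<Longrightarrow> dyadic_idx n t div 2 ^ (n - m) = dyadic_idx m t"
proof (induction n rule: dec_induct)
  case (step n)
  have "dyadic_idx (Suc n) t div 2 ^ (Suc n - m) = dyadic_idx (Suc n) t div 2 div 2 ^ (n - m)"
    using step.hyps by (simp add: Suc_diff_le div_mult2_eq)
  then show ?case using step.IH by (simp add: dyadic_idx_Suc_div)
qed simp

text \<open>An index of the system is a nested pair: \<open>enc l j s\<close> is the \<open>s\<close>-th member of the block that
  simulates the Haar function with support \<open>dyadic_ivl (l - 1) j\<close>; level \<open>0\<close> is the constant function.\<close>

definition enc :: "nat \<Rightarrow> nat \<Rightarrow> nat \<Rightarrow> nat" where
  "enc l j s = prod_encode (prod_encode (l, j), s)"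

lemma inj_enc: "enc l j s = enc l' j' s' \<longleftrightarrow> l = l' \<and> j = j' \<and> s = s'"
  by (auto simp: enc_def dest: injD[OF inj_prod_encode])

text \<open>This makes the system predictable: the interval attached to an index is determined by at
  most that many binary digits, so multiplying its indicator by the Rademacher function of this
  index gives a martingale difference.\<close>

lemma level_le_enc: "l - 1 \<le> enc l j s"
  unfolding enc_def using le_prod_encode_1[of l j] le_prod_encode_1[of "prod_encode (l, j)" s] by linarith

locale haar_translates =
  fixes p :: real
  assumes p4: "4 < p"
begin

text \<open>The value zero past the end of a block lets every natural number be an index, since
  \<open>prod_decode\<close> also yields members s beyond the block length.\<close>

definition wt :: "nat \<Rightarrow> nat \<Rightarrow> real" where
  "wt k s = (if s < block p k then real (block p k) powr (- 1 / 4) else 0)"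

definition c :: "nat \<Rightarrow> real" where
  "c i = (case prod_decode i of (k, s) \<Rightarrow> wt k s)"

text \<open>The predictable multiplier as a function of the interval m of level i: the division
  recovers the ancestor of m at level l - 1, which is compared with j.\<close>

definition V :: "nat \<Rightarrow> nat \<Rightarrow> real" where
  "V i m = (case prod_decode (fst (prod_decode i)) of (l, j) \<Rightarrow>
    c i * of_bool (m div 2 ^ (i - (l - 1)) = j))"

definition u :: "nat \<Rightarrow> real \<Rightarrow> real" where
  "u i t = indicator {0..<1} t * (rad i t * V i (dyadic_idx i t))"

lemma c_enc: "c (enc l j s) = wt (prod_encode (l, j)) s"
  by (simp add: c_def enc_def)

lemma V_enc: "V (enc l j s) (dyadic_idx (enc l j s) t)
    = wt (prod_encode (l, j)) s * of_bool (dyadic_idx (l - 1) t = j)"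
proof -
  have "V (enc l j s) m = c (enc l j s) * of_bool (m div 2 ^ (enc l j s - (l - 1)) = j)" for m
    by (simp add: V_def enc_def)
  then show ?thesis by (simp only: dyadic_idx_div[OF level_le_enc] c_enc)
qed

lemma wt_nonneg: "0 \<le> wt k s"
  by (simp add: wt_def)

lemma c_nonneg: "0 \<le> c i"
  by (simp add: c_def wt_nonneg split: prod.split)

lemma V_le: "\<bar>V i m\<bar> \<le> c i"
  using c_nonneg[of i] by (simp add: V_def split: prod.split)

text \<open>The fourth power arises because the weight enters once through the translate and once
  through its coefficient, and the square function squares the product. This normalisation turns a
  block into a single Haar function.\<close>

lemma sum_wt_sq: "(\<Sum>s<block p k. wt k s ^ 4) = 1"
proof -
  have N: "0 < real (block p k)" using block_spec(1)[OF p4, of k] by simp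
  have "(real (block p k) powr (- 1 / 4)) ^ 4 = real (block p k) powr (- 1)"
    using N by (simp add: powr_powr flip: powr_realpow)
  then show ?thesis using N by (simp add: wt_def powr_minus)
qed

lemma sum_wt_powr: "(\<Sum>s<block p k. wt k s powr p) \<le> (1 / 4) ^ k"
proof -
  have "(\<Sum>s<block p k. wt k s powr p) = real (block p k) * real (block p k) powr (- p / 4)"
    by (simp add: wt_def powr_powr)
  also have "\<dots> = real (block p k) powr (1 - p / 4)"
    using block_spec(1)[OF p4, of k] by (simp add: powr_mult_base)
  also have "\<dots> \<le> (1 / 4) ^ k" by (rule block_spec(2)[OF p4])
  finally show ?thesis .
qed

text \<open>Indices with nonzero weight are grouped by blocks; as k never exceeds the code of (k,
  s), only k < n occurs, and the geometric sum is 4/3.\<close>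

lemma sum_c_powr: "(\<Sum>i<n. c i powr p) \<le> 2"
proof -
  let ?B = "prod_encode ` (SIGMA k:{..<n}. {..<block p k})"
  have fin: "finite ?B" by auto
  have "(\<Sum>i<n. c i powr p) = (\<Sum>i\<in>{..<n} \<inter> ?B. c i powr p)"
  proof (rule sum.mono_neutral_right)
    show "\<forall>i\<in>{..<n} - {..<n} \<inter> ?B. c i powr p = 0"
    proof
      fix i assume i: "i \<in> {..<n} - {..<n} \<inter> ?B"
      obtain k s where ks: "i = prod_encode (k, s)" by (metis prod.exhaust prod_decode_inverse)
      then have "k \<le> i" by (simp add: le_prod_encode_1)
      then have "\<not> s < block p k" using i ks by (auto simp: image_iff)
      then show "c i powr p = 0" by (simp add: ks c_def wt_def)
    qed
  qed auto
  also have "\<dots> \<le> (\<Sum>i\<in>?B. c i powr p)" using fin by (intro sum_mono2) auto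
  also have "\<dots> = (\<Sum>(k, s)\<in>(SIGMA k:{..<n}. {..<block p k}). wt k s powr p)"
    by (subst sum.reindex) (auto simp: c_def inj_on_def case_prod_unfold)
  also have "\<dots> = (\<Sum>k<n. \<Sum>s<block p k. wt k s powr p)" by (subst sum.Sigma) auto
  also have "\<dots> \<le> (\<Sum>k<n. (1 / 4) ^ k)" by (intro sum_mono sum_wt_powr)
  also have "\<dots> \<le> (\<Sum>k. (1 / 4) ^ k)" by (intro sum_le_suminf) auto
  also have "\<dots> \<le> 2" by (simp add: suminf_geometric)
  finally show ?thesis .
qed

text \<open>Setting the multipliers to zero outside I turns a combination over an arbitrary finite
  set into a martingale stopped at time n.\<close>

lemma combination_center:
  fixes a :: "nat \<Rightarrow> real"
  assumes I: "finite I" and n: "I \<subseteq> {..<n}"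
  defines "W \<equiv> (\<lambda>i m. if i \<in> I then a i * V i m else 0)"
  shows "(\<lambda>t. \<Sum>i\<in>I. a i * u i t) \<in> Lp p"
    and "Lp_int p (\<lambda>t. \<Sum>i\<in>I. a i * u i t) = mart_int p 0 W n"
    and "sq_int p 0 W n = (LINT t:{0..<1}|lebesgue. (\<Sum>i\<in>I. (a i * V i (dyadic_idx i t))\<^sup>2) powr (p / 2))"
proof -
  have 1: "(\<Sum>i\<in>I. a i * u i t) = indicator {0..<1} t * (0 + (\<Sum>i<n. rad i t * W i (dyadic_idx i t)))" for t
  proof -
    have "(\<Sum>i<n. rad i t * W i (dyadic_idx i t)) = (\<Sum>i\<in>I. a i * (rad i t * V i (dyadic_idx i t)))"
      unfolding W_def using n by (intro sum.mono_neutral_cong_right) auto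
    then show ?thesis by (simp add: u_def sum_distrib_left mult_ac)
  qed
  have 2: "\<bar>\<Sum>i\<in>I. a i * u i t\<bar> powr p
      = indicator {0..<1} t *\<^sub>R \<bar>0 + (\<Sum>i<n. rad i t * W i (dyadic_idx i t))\<bar> powr p" for t
    unfolding 1 by (simp add: indicator_def)
  have "(\<lambda>t. \<Sum>i\<in>I. a i * u i t) \<in> borel_measurable lebesgue"
    unfolding 1 using has_integral_dyadic_step(1)[of "dyadic_mart 0 W n" n]
    by (simp add: dyadic_mart_idx set_integrable_def)
  then show "(\<lambda>t. \<Sum>i\<in>I. a i * u i t) \<in> Lp p"
    using mart_int_integrable[where a = 0 and n = n and W = W and p = p] by (intro LpI) (simp_all only: 2 set_integrable_def)
  show "Lp_int p (\<lambda>t. \<Sum>i\<in>I. a i * u i t) = mart_int p 0 W n"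
    unfolding Lp_int_def mart_int_def set_lebesgue_integral_def 2 ..
  have "(\<Sum>i<n. (W i (dyadic_idx i t))\<^sup>2) = (\<Sum>i\<in>I. (a i * V i (dyadic_idx i t))\<^sup>2)" for t
    unfolding W_def using n by (intro sum.mono_neutral_cong_right) auto
  then show "sq_int p 0 W n = (LINT t:{0..<1}|lebesgue. (\<Sum>i\<in>I. (a i * V i (dyadic_idx i t))\<^sup>2) powr (p / 2))"
    by (simp add: sq_int_def)
qed

lemma u_Lp: "u i \<in> Lp p" and u_int: "Lp_int p (u i) \<le> c i powr p"
proof -
  show *: "u i \<in> Lp p" using combination_center(1)[of "{i}" "Suc i" "\<lambda>_. 1"] by simp
  have le: "\<bar>u i t\<bar> powr p \<le> indicator {0..<1} t * c i powr p" for t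
    using V_le[of i "dyadic_idx i t"] p4
    by (auto simp: u_def abs_mult indicator_def intro: powr_mono2)
  have "integrable lebesgue (\<lambda>t. indicator {0..<1::real} t * c i powr p)" by simp
  from integral_mono[OF Lp_integrable[OF *] this le]
  have "Lp_int p (u i) \<le> (LINT t|lebesgue. indicator {0..<1::real} t * c i powr p)"
    by (simp only: Lp_int_def)
  then show "Lp_int p (u i) \<le> c i powr p" by simp
qed

sublocale lacunary_sum p u
proof
  show "0 < p" using p4 by simp
  show "u i x = 0" if "x \<notin> {0..<1}" for i x using that by (simp add: u_def)
  show "u i \<in> Lp p" for i by (rule u_Lp)
  have "summable (\<lambda>i. c i powr p)"
    by (rule summableI_nonneg_bounded[of _ 2]) (auto intro: sum_c_powr)
  then show "summable (\<lambda>i. Lp_int p (u i))"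
    by (rule summable_comparison_test'[where N = 0]) (use u_int in auto)
qed

definition sq :: "nat set \<Rightarrow> (nat \<Rightarrow> real) \<Rightarrow> real" where
  "sq I a = (LINT t:{0..<1}|lebesgue. (\<Sum>i\<in>I. (a i * V i (dyadic_idx i t))\<^sup>2) powr (p / 2))"

lemma center_equiv:
  "\<exists>C>0. \<forall>I a. finite I \<longrightarrow> Lp_int p (\<lambda>t. \<Sum>i\<in>I. a i * u i t) \<le> C * sq I a \<and>
    sq I a \<le> C * Lp_int p (\<lambda>t. \<Sum>i\<in>I. a i * u i t)"
proof -
  obtain C where C: "C > 0" "\<And>a W n. mart_int p a W n \<le> C * sq_int p a W n \<and> sq_int p a W n \<le> C * mart_int p a W n"
    using square_function[OF p4] by metis
  have "Lp_int p (\<lambda>t. \<Sum>i\<in>I. a i * u i t) \<le> C * sq I a \<and> sq I a \<le> C * Lp_int p (\<lambda>t. \<Sum>i\<in>I. a i * u i t)"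
    if I: "finite I" for I a
  proof -
    obtain n where n: "I \<subseteq> {..<n}" using I finite_nat_iff_bounded by blast
    show ?thesis unfolding sq_def
      using C(2)[of 0 "\<lambda>i m. if i \<in> I then a i * V i m else 0" n] combination_center(2,3)[OF I n, of a] by simp
  qed
  then show ?thesis using C(1) by blast
qed

lemma sq_integrable:
  assumes "finite I"
  shows "set_integrable lebesgue {0..<1} (\<lambda>t. (\<Sum>i\<in>I. (a i * V i (dyadic_idx i t))\<^sup>2) powr (p / 2))"
proof -
  obtain n where n: "I \<subseteq> {..<n}" using assms finite_nat_iff_bounded by blast
  have "(\<Sum>i<n. (if i \<in> I then a i * V i (dyadic_idx i t) else 0)\<^sup>2) = (\<Sum>i\<in>I. (a i * V i (dyadic_idx i t))\<^sup>2)" for t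
    using n by (intro sum.mono_neutral_cong_right) auto
  then show ?thesis
    using sq_int_integrable[where a = 0 and n = n and W = "\<lambda>i m. if i \<in> I then a i * V i m else 0" and p = p] by simp
qed

text \<open>The reason for unconditionality: dropping indices only removes nonnegative terms from
  the square function.\<close>

lemma sq_mono:
  assumes "finite J" "I \<subseteq> J"
  shows "sq I a \<le> sq J a"
  unfolding sq_def
  using assms p4 finite_subset[OF assms(2,1)]
  by (intro set_integral_mono sq_integrable powr_mono2 sum_mono2) (auto intro: sum_nonneg)

definition \<Lambda> :: "int set" where
  "\<Lambda> = range (\<lambda>i. 3 ^ i)"

lemma lin_comb_image:
  "lin_comb f ((\<lambda>i. 3 ^ i) ` I) a = (\<lambda>x. \<Sum>i\<in>I. a (3 ^ i) * f (x - 3 ^ i))"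
proof -
  have "inj_on (\<lambda>i. (3::int) ^ i) I" by (auto simp: inj_on_def)
  then show ?thesis by (simp add: lin_comb_def translate_def sum.reindex)
qed

lemma unconditional:
  assumes pos: "0 < Lp_int p f"
  shows "unconditional_basic p f \<Lambda>"
proof -
  obtain C where C: "C > 0" "\<And>I a. finite I \<Longrightarrow> Lp_int p (\<lambda>t. \<Sum>i\<in>I. a i * u i t) \<le> C * sq I a"
    "\<And>I a. finite I \<Longrightarrow> sq I a \<le> C * Lp_int p (\<lambda>t. \<Sum>i\<in>I. a i * u i t)"
    using center_equiv by blast
  show ?thesis
  \<comment> \<open>\<open>C * C\<close> is the cost of passing to the square function and back on
    [0,1); the added 1 covers the off-centre part, which is itself monotone.\<close>
  proof (rule unconditional_basicI[where K = "C * C + 1", OF p f_Lp pos])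
    show "0 < C * C + 1" using C(1) by (simp add: add_pos_pos)
    fix F G and a :: "int \<Rightarrow> real" assume FG: "finite G" "F \<subseteq> G" "G \<subseteq> \<Lambda>"
    then obtain J where J: "G = (\<lambda>i. 3 ^ i) ` J" "finite J"
      unfolding \<Lambda>_def by (metis finite_subset_image)
    obtain I where I: "F = (\<lambda>i. 3 ^ i) ` I" "I \<subseteq> J"
      using FG J by (metis subset_image_iff)
    have finI: "finite I" using I J finite_subset by blast
    define \<alpha> where "\<alpha> = (\<lambda>i::nat. a (3 ^ i))"
    let ?c = "\<lambda>I. Lp_int p (\<lambda>t. \<Sum>i\<in>I. \<alpha> i * u i t)"
    let ?r = "\<lambda>I. \<Sum>i\<in>I. \<bar>\<alpha> i\<bar> powr p * (Lp_int p f - Lp_int p (u i))"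
    have r0: "0 \<le> \<bar>\<alpha> i\<bar> powr p * (Lp_int p f - Lp_int p (u i))" for i
      using u_le_f[of i] by simp
    have "Lp_int p (lin_comb f F a) = ?c I + ?r I"
      unfolding I(1) lin_comb_image norm_formula[OF finI] \<alpha>_def ..
    also have "?c I \<le> C * sq I \<alpha>" by (rule C(2)[OF finI])
    also have "\<dots> \<le> C * sq J \<alpha>" using C(1) sq_mono[OF J(2) I(2)] by (intro mult_left_mono) auto
    also have "\<dots> \<le> C * (C * ?c J)" using C(1) C(3)[OF J(2)] by (intro mult_left_mono) auto
    also have "?r I \<le> ?r J" using J(2) I(2) r0 by (intro sum_mono2) auto
    also have "C * (C * ?c J) + ?r J \<le> (C * C + 1) * (?c J + ?r J)"
    proof -
      have "0 \<le> ?r J" by (intro sum_nonneg r0)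
      then have "0 \<le> C * C * ?r J" using C(1) by simp
      moreover have "0 \<le> ?c J" by simp
      ultimately show ?thesis by (simp add: algebra_simps)
    qed
    also have "?c J + ?r J = Lp_int p (lin_comb f G a)"
      unfolding J(1) lin_comb_image norm_formula[OF J(2)] \<alpha>_def ..
    finally show "Lp_int p (lin_comb f F a) \<le> (C * C + 1) * Lp_int p (lin_comb f G a)" by simp
  qed
qed

end

section \<open>Block sums as a copy of the Haar system\<close>

context haar_translates
begin

text \<open>By truncated subtraction levels 0 and 1 both have the single interval [0,1): level 0
  carries the constant function, level 1 the first Haar function.\<close>

definition idx_set :: "nat set \<Rightarrow> nat set" where
  "idx_set L = (\<lambda>(l, j, s). enc l j s) `
    (SIGMA l:L. SIGMA j:{..<2 ^ (l - 1)}. {..<block p (prod_encode (l, j))})"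

text \<open>The block weight is used a second time here, as the coefficient common to all members of
  a block.\<close>

definition coef :: "(nat \<Rightarrow> nat \<Rightarrow> real) \<Rightarrow> nat \<Rightarrow> real" where
  "coef d i = c i * (case prod_decode (fst (prod_decode i)) of (l, j) \<Rightarrow> d l j)"

definition Z :: "nat set \<Rightarrow> (nat \<Rightarrow> nat \<Rightarrow> real) \<Rightarrow> real \<Rightarrow> real" where
  "Z L d x = (\<Sum>i\<in>idx_set L. coef d i * f (x - 3 ^ i))"

text \<open>The squared square function of the Haar series with coefficients d, for Haar functions
  of values 1 and -1, not normalised in L_p.\<close>

definition Sq :: "nat set \<Rightarrow> (nat \<Rightarrow> nat \<Rightarrow> real) \<Rightarrow> real \<Rightarrow> real" where
  "Sq L d t = (\<Sum>l\<in>L. (d l (dyadic_idx (l - 1) t))\<^sup>2)"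

definition Sq_int :: "nat set \<Rightarrow> (nat \<Rightarrow> nat \<Rightarrow> real) \<Rightarrow> real" where
  "Sq_int L d = (LINT t:{0..<1}|lebesgue. Sq L d t powr (p / 2))"

lemma Sq_nonneg: "0 \<le> Sq L d t"
  by (simp add: Sq_def sum_nonneg)

lemma coef_enc: "coef d (enc l j s) = wt (prod_encode (l, j)) s * d l j"
  by (simp add: coef_def c_enc) (simp add: enc_def)

lemma finite_idx_set: "finite L \<Longrightarrow> finite (idx_set L)"
  unfolding idx_set_def by (intro finite_imageI finite_SigmaI) auto

lemma sum_idx_set:
  fixes h :: "nat \<Rightarrow> real"
  assumes "finite L"
  shows "(\<Sum>i\<in>idx_set L. h i)
    = (\<Sum>l\<in>L. \<Sum>j<2 ^ (l - 1). \<Sum>s<block p (prod_encode (l, j)). h (enc l j s))"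
proof -
  have "inj_on (\<lambda>(l, j, s). enc l j s) (SIGMA l:L. SIGMA j:{..<2 ^ (l - 1)}. {..<block p (prod_encode (l, j))})"
    by (auto simp: inj_on_def inj_enc)
  then show ?thesis
    using assms unfolding idx_set_def
    by (simp add: sum.reindex sum.Sigma split_beta')
qed

lemma sum_idx_set_sq:
  assumes L: "finite L" and t: "t \<in> {0..<1}"
  shows "(\<Sum>i\<in>idx_set L. (coef d i * V i (dyadic_idx i t))\<^sup>2) = Sq L d t"
proof -
  have "(\<Sum>i\<in>idx_set L. (coef d i * V i (dyadic_idx i t))\<^sup>2)
      = (\<Sum>l\<in>L. \<Sum>j<2 ^ (l - 1). (d l j)\<^sup>2 * of_bool (dyadic_idx (l - 1) t = j) * (\<Sum>s<block p (prod_encode (l, j)). wt (prod_encode (l, j)) s ^ 4))"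
    unfolding sum_idx_set[OF L] coef_enc V_enc sum_distrib_left
    by (intro sum.cong refl) (auto simp: power2_eq_square power4_eq_xxxx)
  also have "\<dots> = (\<Sum>l\<in>L. \<Sum>j<2 ^ (l - 1). if dyadic_idx (l - 1) t = j then (d l j)\<^sup>2 else 0)"
    unfolding sum_wt_sq by (intro sum.cong refl) auto
  also have "\<dots> = Sq L d t"
    unfolding Sq_def using t by (intro sum.cong refl) (auto simp: dyadic_idx_less)
  finally show ?thesis .
qed

lemma sq_idx_set:
  assumes "finite L"
  shows "sq (idx_set L) (coef d) = Sq_int L d"
    and "set_integrable lebesgue {0..<1} (\<lambda>t. Sq L d t powr (p / 2))"
proof -
  have *: "indicator {0..<1} t *\<^sub>R ((\<Sum>i\<in>idx_set L. (coef d i * V i (dyadic_idx i t))\<^sup>2) powr (p / 2))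
      = indicator {0..<1} t *\<^sub>R (Sq L d t powr (p / 2))" for t
    using sum_idx_set_sq[OF assms, of t d] by (cases "t \<in> {0..<1::real}") simp_all
  show "sq (idx_set L) (coef d) = Sq_int L d"
    unfolding sq_def Sq_int_def set_lebesgue_integral_def * ..
  show "set_integrable lebesgue {0..<1} (\<lambda>t. Sq L d t powr (p / 2))"
    using sq_integrable[OF finite_idx_set[OF assms], of "coef d"] unfolding set_integrable_def * .
qed

text \<open>On an interval of length 2^(-(l-1)) the function \<open>Sq L d\<close> is at least (d l
  j)^2; integrating over this interval alone gives the bound.\<close>

lemma coefficient_le_Sq_int:
  assumes L: "finite L" "l \<in> L" and j: "j < 2 ^ (l - 1)"
  shows "\<bar>d l j\<bar> powr p \<le> 2 ^ (l - 1) * Sq_int L d"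
proof -
  let ?g = "\<lambda>i. if i = j then \<bar>d l j\<bar> powr p else 0"
  have "(LINT t:{0..<1}|lebesgue. ?g (dyadic_idx (l - 1) t)) \<le> Sq_int L d"
    unfolding Sq_int_def
  proof (intro set_integral_mono has_integral_dyadic_step(1) sq_idx_set(2) L(1))
    fix t :: real
    have "((d l j)\<^sup>2) powr (p / 2) \<le> Sq L d t powr (p / 2)" if "dyadic_idx (l - 1) t = j"
    proof (intro powr_mono2)
      have "(d l (dyadic_idx (l - 1) t))\<^sup>2 \<le> Sq L d t"
        unfolding Sq_def by (rule member_le_sum[OF L(2) _ L(1)]) simp
      then show "(d l j)\<^sup>2 \<le> Sq L d t" using that by simp
    qed (use p4 in auto)
    then show "?g (dyadic_idx (l - 1) t) \<le> Sq L d t powr (p / 2)"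
      by (simp add: power2_powr_half)
  qed
  also have "(LINT t:{0..<1}|lebesgue. ?g (dyadic_idx (l - 1) t)) = \<bar>d l j\<bar> powr p / 2 ^ (l - 1)"
    using j by (subst has_integral_dyadic_step(2)) simp
  finally show ?thesis by (simp add: field_simps)
qed

lemma Sq_int_nonneg: "0 \<le> Sq_int L d"
  unfolding Sq_int_def set_lebesgue_integral_def by (intro Bochner_Integration.integral_nonneg) auto

text \<open>A block with code k contributes at most 2^(l-1) 4^(-k) times \<open>Sq_int L d\<close>.
  Since l - 1 <= k this is at most 2^(-k) times it, and distinct blocks have distinct codes, so the
  total is at most 2.\<close>

lemma off_center_le:
  assumes L: "finite L"
  shows "(\<Sum>i\<in>idx_set L. \<bar>coef d i\<bar> powr p) \<le> 2 * Sq_int L d"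
proof -
  let ?S = "SIGMA l:L. {..<2 ^ (l - 1) :: nat}"
  have "(\<Sum>i\<in>idx_set L. \<bar>coef d i\<bar> powr p)
      = (\<Sum>l\<in>L. \<Sum>j<2 ^ (l - 1). \<bar>d l j\<bar> powr p * (\<Sum>s<block p (prod_encode (l, j)). wt (prod_encode (l, j)) s powr p))"
    unfolding sum_idx_set[OF L] coef_enc sum_distrib_left
    by (intro sum.cong refl) (simp add: abs_mult powr_mult wt_nonneg mult.commute)
  also have "\<dots> \<le> (\<Sum>l\<in>L. \<Sum>j<2 ^ (l - 1). (1 / 2) ^ prod_encode (l, j) * Sq_int L d)"
  proof (intro sum_mono)
    fix l j :: nat assume l: "l \<in> L" and j: "j \<in> {..<2 ^ (l - 1)}"
    let ?k = "prod_encode (l, j)"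
    have "\<bar>d l j\<bar> powr p * (\<Sum>s<block p ?k. wt ?k s powr p) \<le> (2 ^ (l - 1) * Sq_int L d) * (1 / 4) ^ ?k"
      using l j L by (intro mult_mono sum_wt_powr coefficient_le_Sq_int) (auto intro: sum_nonneg simp: Sq_int_nonneg)
    also have "\<dots> \<le> (2 ^ ?k * Sq_int L d) * (1 / 4) ^ ?k"
      using le_prod_encode_1[of l j] by (intro mult_right_mono power_increasing) (auto simp: Sq_int_nonneg)
    also have "\<dots> = (1 / 2) ^ ?k * Sq_int L d"
    proof -
      have "(2::real) ^ ?k * (1 / 4) ^ ?k = (1 / 2) ^ ?k" by (simp flip: power_mult_distrib)
      then show ?thesis by (simp add: mult_ac)
    qed
    finally show "\<bar>d l j\<bar> powr p * (\<Sum>s<block p ?k. wt ?k s powr p) \<le> (1 / 2) ^ ?k * Sq_int L d" .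
  qed
  also have "\<dots> = (\<Sum>lj\<in>?S. (1 / 2) ^ prod_encode lj) * Sq_int L d"
    using L by (simp add: sum.Sigma sum_distrib_right split_beta')
  also have "(\<Sum>lj\<in>?S. (1 / 2) ^ prod_encode lj) = (\<Sum>k\<in>prod_encode ` ?S. (1 / 2 :: real) ^ k)"
    by (subst sum.reindex) (auto simp: inj_on_def)
  also have "\<dots> \<le> (\<Sum>k. (1 / 2) ^ k)"
    using L by (intro sum_le_suminf) auto
  also have "(\<Sum>k. (1 / 2 :: real) ^ k) = 2" by (simp add: suminf_geometric)
  finally show ?thesis using Sq_int_nonneg by (simp add: mult_right_mono)
qed

text \<open>The lower bound discards the nonnegative off-centre part; in the upper bound that part
  is at most 2 \<open>Lp_int p f\<close> times the square function integral, whence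
  \<open>K\<close>.\<close>

theorem Z_equiv:
  "\<exists>K>0. \<forall>L d. finite L \<longrightarrow> Lp_int p (Z L d) \<le> K * Sq_int L d \<and> Sq_int L d \<le> K * Lp_int p (Z L d)"
proof -
  obtain C where C: "C > 0" "\<And>I a. finite I \<Longrightarrow> Lp_int p (\<lambda>t. \<Sum>i\<in>I. a i * u i t) \<le> C * sq I a"
    "\<And>I a. finite I \<Longrightarrow> sq I a \<le> C * Lp_int p (\<lambda>t. \<Sum>i\<in>I. a i * u i t)"
    using center_equiv by blast
  define K where "K = C + 2 * Lp_int p f"
  have CK: "C \<le> K" "0 < K" using C(1) by (simp_all add: K_def add_pos_nonneg)
  have "Lp_int p (Z L d) \<le> K * Sq_int L d \<and> Sq_int L d \<le> K * Lp_int p (Z L d)" if L: "finite L" for L d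
  proof -
    let ?I = "idx_set L"
    let ?c = "Lp_int p (\<lambda>t. \<Sum>i\<in>?I. coef d i * u i t)"
    let ?r = "\<Sum>i\<in>?I. \<bar>coef d i\<bar> powr p * (Lp_int p f - Lp_int p (u i))"
    have Z: "Lp_int p (Z L d) = ?c + ?r"
      unfolding Z_def by (rule norm_formula[OF finite_idx_set[OF L]])
    have r0: "0 \<le> ?r" using u_le_f by (intro sum_nonneg) auto
    have "?r \<le> (\<Sum>i\<in>?I. \<bar>coef d i\<bar> powr p * Lp_int p f)"
      by (intro sum_mono mult_left_mono) auto
    also have "\<dots> \<le> 2 * Sq_int L d * Lp_int p f"
      unfolding sum_distrib_right[symmetric] using off_center_le[OF L] by (intro mult_right_mono) auto
    finally have r: "?r \<le> 2 * Sq_int L d * Lp_int p f" .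
    have c1: "?c \<le> C * Sq_int L d" and c2: "Sq_int L d \<le> C * ?c"
      using C(2,3)[OF finite_idx_set[OF L], of "coef d"] sq_idx_set(1)[OF L, of d] by simp_all
    have "Lp_int p (Z L d) \<le> K * Sq_int L d"
      using c1 r by (simp add: Z K_def algebra_simps)
    moreover have "Sq_int L d \<le> K * Lp_int p (Z L d)"
    proof -
      have "C * ?c \<le> K * (?c + ?r)" using CK r0 by (intro mult_mono) auto
      then show ?thesis using c2 unfolding Z by linarith
    qed
    ultimately show ?thesis by blast
  qed
  then show ?thesis using CK(2) by blast
qed

lemma Z_Lp: "Z L d \<in> Lp p"
  unfolding Z_def using p by (intro Lp_sum Lp_scale(1) f_translate_Lp(1)) auto

lemma Z_lin_comb: "Z L d = lin_comb f ((\<lambda>i. 3 ^ i) ` idx_set L) (\<lambda>l. coef d (the_inv (\<lambda>i. 3 ^ i) l))"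
proof -
  have "inj (\<lambda>i. (3::int) ^ i)" by (auto simp: inj_on_def)
  then show ?thesis unfolding lin_comb_image by (simp add: the_inv_f_f Z_def fun_eq_iff)
qed

text \<open>If f vanished in norm, so would every combination of translates, but the block of the
  constant function has square function 1 on [0,1).\<close>

lemma f_pos: "0 < Lp_int p f"
proof (rule ccontr)
  assume "\<not> 0 < Lp_int p f"
  then have f0: "Lp_int p f = 0" using Lp_int_nonneg[of p f] by linarith
  have z: "Lp_int p (\<lambda>x. \<Sum>i\<in>I. a i * f (x - 3 ^ i)) = 0" if "finite I" for I a
    using that
  proof (induction I)
    case (insert i I)
    have "Lp_int p (\<lambda>x. a i * f (x - 3 ^ i) + (\<Sum>i\<in>I. a i * f (x - 3 ^ i)))
        \<le> 2 powr p * (Lp_int p (\<lambda>x. a i * f (x - 3 ^ i)) + Lp_int p (\<lambda>x. \<Sum>i\<in>I. a i * f (x - 3 ^ i)))"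
      using p by (intro Lp_add(2) Lp_sum Lp_scale(1) f_translate_Lp(1)) auto
    also have "\<dots> = 0"
      using insert.IH f0 by (simp add: Lp_scale(2)[OF f_translate_Lp(1)] f_translate_Lp(2))
    finally show ?case using insert.hyps by (simp add: antisym)
  qed simp
  obtain K where "\<forall>L d. finite L \<longrightarrow> Lp_int p (Z L d) \<le> K * Sq_int L d \<and> Sq_int L d \<le> K * Lp_int p (Z L d)"
    using Z_equiv by blast
  then have "Sq_int {0} (\<lambda>l j. 1) \<le> K * Lp_int p (Z {0} (\<lambda>l j. 1))" by simp
  also have "\<dots> = 0" unfolding Z_def using z[OF finite_idx_set[of "{0}"]] by simp
  finally show False by (simp add: Sq_int_def Sq_def set_lebesgue_integral_def)
qed

end

subsection \<open>Dyadic averages\<close>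

definition avg :: "(real \<Rightarrow> real) \<Rightarrow> nat \<Rightarrow> nat \<Rightarrow> real" where
  "avg g n j = 2 ^ n * (LINT t:dyadic_ivl n j|lebesgue. g t)"

text \<open>Half the difference of left and right averages is the amount by which the left one
  exceeds the average over the parent; the sign agrees with that of \<open>(-1) ^ j\<close> in
  \<open>dyadic_mart\<close>.\<close>

definition haar_coef :: "(real \<Rightarrow> real) \<Rightarrow> nat \<Rightarrow> nat \<Rightarrow> real" where
  "haar_coef g l j = (case l of 0 \<Rightarrow> avg g 0 j
     | Suc n \<Rightarrow> (avg g (Suc n) (2 * j) - avg g (Suc n) (2 * j + 1)) / 2)"

lemma dyadic_ivl_sets [measurable]: "dyadic_ivl n j \<in> sets lebesgue" "dyadic_ivl n j \<in> sets borel"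
  by (simp_all add: dyadic_ivl_def)

lemma dyadic_ivl_split:
  "dyadic_ivl n j = dyadic_ivl (Suc n) (2 * j) \<union> dyadic_ivl (Suc n) (2 * j + 1)"
  "dyadic_ivl (Suc n) (2 * j) \<inter> dyadic_ivl (Suc n) (2 * j + 1) = {}"
proof -
  have "dyadic_idx n t = j \<longleftrightarrow> dyadic_idx (Suc n) t = 2 * j \<or> dyadic_idx (Suc n) t = 2 * j + 1" for t
    unfolding dyadic_idx_Suc_div[of n t, symmetric] by presburger
  then show "dyadic_ivl n j = dyadic_ivl (Suc n) (2 * j) \<union> dyadic_ivl (Suc n) (2 * j + 1)"
    by (auto simp: dyadic_ivl_iff)
  show "dyadic_ivl (Suc n) (2 * j) \<inter> dyadic_ivl (Suc n) (2 * j + 1) = {}"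
    by (auto simp: dyadic_ivl_iff)
qed

lemma dyadic_ivl_subset: "j < 2 ^ n \<Longrightarrow> dyadic_ivl n j \<subseteq> {0..<1}"
proof -
  assume "j < 2 ^ n"
  then have "real j + 1 \<le> 2 ^ n"
    by (metis Suc_leI of_nat_Suc of_nat_le_numeral_power_cancel_iff add.commute)
  then have "(real j + 1) / 2 ^ n \<le> 1" by simp
  moreover have "0 \<le> real j / 2 ^ n" by simp
  ultimately show ?thesis
    unfolding dyadic_ivl_def subset_iff atLeastLessThan_iff by (meson le_less_trans less_le_trans order_trans)
qed

lemma measure_dyadic_ivl: "measure lebesgue (dyadic_ivl n j) = 1 / 2 ^ n"
  by (simp add: dyadic_ivl_def divide_right_mono field_simps)

lemma set_integrable_dyadic_const: "set_integrable lebesgue (dyadic_ivl n j) (\<lambda>t. c :: real)"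
  unfolding set_integrable_def by (simp add: dyadic_ivl_def divide_right_mono)

lemma set_integrable_dyadic: "integrable lebesgue g \<Longrightarrow> set_integrable lebesgue (dyadic_ivl n j) g"
  for g :: "real \<Rightarrow> real"
  unfolding set_integrable_def by (rule integrable_mult_indicator[OF dyadic_ivl_sets(1)])

lemma set_integral_dyadic_const: "(LINT t:dyadic_ivl n j|lebesgue. c :: real) = c / 2 ^ n"
  by (simp add: set_lebesgue_integral_def measure_dyadic_ivl)

lemma avg_split:
  assumes "integrable lebesgue g"
  shows "avg g n j = (avg g (Suc n) (2 * j) + avg g (Suc n) (2 * j + 1)) / 2"
proof -
  have "(LINT t:dyadic_ivl n j|lebesgue. g t) =
      (LINT t:dyadic_ivl (Suc n) (2 * j)|lebesgue. g t) + (LINT t:dyadic_ivl (Suc n) (2 * j + 1)|lebesgue. g t)"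
    unfolding dyadic_ivl_split(1)[of n j]
    by (intro set_integral_Un dyadic_ivl_split(2) set_integrable_dyadic assms)
  then show ?thesis by (simp add: avg_def algebra_simps)
qed

lemma avg_linear:
  assumes "integrable lebesgue g" "integrable lebesgue h"
  shows "avg (\<lambda>x. a * g x + b * h x) n j = a * avg g n j + b * avg h n j"
  unfolding avg_def using set_integrable_dyadic[OF assms(1), of n j] set_integrable_dyadic[OF assms(2), of n j]
  by (subst set_integral_add) (auto simp: algebra_simps)

lemma haar_coef_linear:
  assumes "integrable lebesgue g" "integrable lebesgue h"
  shows "haar_coef (\<lambda>x. a * g x + b * h x) l j = a * haar_coef g l j + b * haar_coef h l j"
  by (simp add: haar_coef_def avg_linear[OF assms] field_simps split: nat.split)

lemma dyadic_mart_avg: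
  assumes g: "integrable lebesgue g"
  shows "j < 2 ^ n \<Longrightarrow> dyadic_mart (avg g 0 0) (\<lambda>n. haar_coef g (Suc n)) n j = avg g n j"
proof (induction n arbitrary: j)
  case (Suc n)
  define i where "i = j div 2"
  have i: "i < 2 ^ n" using Suc.prems by (simp add: i_def less_mult_imp_div_less)
  note s = avg_split[OF g, of n i]
  have "j = 2 * i \<or> j = 2 * i + 1" unfolding i_def by presburger
  then show ?case
    using Suc.IH[OF i] s by (auto simp: haar_coef_def field_simps)
qed simp

lemma Lp_imp_integrable:
  assumes p: "1 \<le> p" and g: "g \<in> Lp p" and supp: "\<And>x. x \<notin> {0..<1} \<Longrightarrow> g x = 0"
  shows "integrable lebesgue g"
proof (rule Bochner_Integration.integrable_bound)
  show "integrable lebesgue (\<lambda>x. indicator {0..<1::real} x + \<bar>g x\<bar> powr p)"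
    using Lp_integrable[OF g] by simp
  have "\<bar>g x\<bar> \<le> indicator {0..<1} x + \<bar>g x\<bar> powr p" for x
  proof (cases "\<bar>g x\<bar> \<le> 1")
    case False
    then have "\<bar>g x\<bar> powr 1 \<le> \<bar>g x\<bar> powr p" using p by (intro powr_mono) auto
    then show ?thesis by (simp add: add_increasing)
  next
    case True
    then show ?thesis using supp[of x] powr_ge_zero[of "\<bar>g x\<bar>" p] unfolding indicator_def
      by (cases "x \<in> {0..<1}") (simp_all del: powr_ge_zero)
  qed
  then show "AE x in lebesgue. norm (g x) \<le> norm (indicator {0..<1} x + \<bar>g x\<bar> powr p)"
    by simp
qed (use Lp_measurable[OF g] in simp)

text \<open>Jensen's inequality for |x|^p, obtained by integrating the tangent inequality at the
  point b = |average|.\<close>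

lemma avg_powr_le:
  assumes p: "1 \<le> p" and g: "g \<in> Lp p" and int: "integrable lebesgue g"
  shows "\<bar>avg g n j\<bar> powr p \<le> 2 ^ n * (LINT t:dyadic_ivl n j|lebesgue. \<bar>g t\<bar> powr p)"
proof -
  define b where "b = \<bar>avg g n j\<bar>"
  let ?D = "dyadic_ivl n j"
  have gp: "set_integrable lebesgue ?D (\<lambda>t. \<bar>g t\<bar> powr p)"
    by (intro set_integrable_dyadic Lp_integrable g)
  have ga: "set_integrable lebesgue ?D (\<lambda>t. \<bar>g t\<bar>)"
    using int by (intro set_integrable_dyadic) simp
  note c = set_integrable_dyadic_const
  have lin: "set_integrable lebesgue ?D (\<lambda>t. (b powr p - p * b powr (p - 1) * b) + p * b powr (p - 1) * \<bar>g t\<bar>)"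
    using c ga by (intro set_integral_add(1)) auto
  have "b \<le> 2 ^ n * (LINT t:?D|lebesgue. \<bar>g t\<bar>)"
    unfolding b_def avg_def abs_mult
    using set_integral_norm_bound[OF set_integrable_dyadic[OF int], of n j] by simp
  then have "p * b powr (p - 1) * b \<le> p * b powr (p - 1) * (2 ^ n * (LINT t:?D|lebesgue. \<bar>g t\<bar>))"
    using p by (intro mult_left_mono) auto
  then have "b powr p \<le> b powr p - p * b powr (p - 1) * b + p * b powr (p - 1) * (2 ^ n * (LINT t:?D|lebesgue. \<bar>g t\<bar>))"
    by simp
  also have "\<dots> = 2 ^ n * (LINT t:?D|lebesgue. (b powr p - p * b powr (p - 1) * b) + p * b powr (p - 1) * \<bar>g t\<bar>)"
    using c ga by (subst set_integral_add(2)) (auto simp: set_integral_dyadic_const field_simps)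
  also have "\<dots> \<le> 2 ^ n * (LINT t:?D|lebesgue. \<bar>g t\<bar> powr p)"
  proof (intro mult_left_mono set_integral_mono lin gp)
    show "(b powr p - p * b powr (p - 1) * b) + p * b powr (p - 1) * \<bar>g t\<bar> \<le> \<bar>g t\<bar> powr p" for t
      using powr_above_tangent[OF p, of b "\<bar>g t\<bar>"] by (simp add: b_def algebra_simps)
  qed simp
  finally show ?thesis by (simp add: b_def)
qed

text \<open>The conditional expectation of g on [0,1) given the first n binary digits.\<close>

definition cond_avg :: "(real \<Rightarrow> real) \<Rightarrow> nat \<Rightarrow> real \<Rightarrow> real" where
  "cond_avg g n t = indicator {0..<1} t * avg g n (dyadic_idx n t)"

lemma cond_avg_powr: "\<bar>cond_avg g n t\<bar> powr p = indicator {0..<1} t *\<^sub>R \<bar>avg g n (dyadic_idx n t)\<bar> powr p"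
  by (simp add: cond_avg_def indicator_def)

lemma cond_avg_Lp: "cond_avg g n \<in> Lp p"
  and cond_avg_int: "Lp_int p (cond_avg g n) = (\<Sum>j<2 ^ n. \<bar>avg g n j\<bar> powr p) / 2 ^ n"
proof -
  have "cond_avg g n \<in> borel_measurable lebesgue"
    using borel_measurable_integrable[OF has_integral_dyadic_step(1)[of "avg g n" n, unfolded set_integrable_def]]
    by (simp add: cond_avg_def[abs_def])
  then show "cond_avg g n \<in> Lp p"
    using has_integral_dyadic_step(1)[of "\<lambda>j. \<bar>avg g n j\<bar> powr p" n]
    by (intro LpI) (simp_all only: cond_avg_powr set_integrable_def)
  show "Lp_int p (cond_avg g n) = (\<Sum>j<2 ^ n. \<bar>avg g n j\<bar> powr p) / 2 ^ n"
    using has_integral_dyadic_step(2)[of "\<lambda>j. \<bar>avg g n j\<bar> powr p" n]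
    unfolding Lp_int_def cond_avg_powr set_lebesgue_integral_def .
qed

lemma cond_avg_contraction:
  assumes p: "1 \<le> p" and g: "g \<in> Lp p" and int: "integrable lebesgue g"
  shows "Lp_int p (cond_avg g n) \<le> Lp_int p g"
proof -
  have "(\<Sum>j<2 ^ n. \<bar>avg g n j\<bar> powr p) / 2 ^ n \<le> (\<Sum>j<2 ^ n. 2 ^ n * (LINT t:dyadic_ivl n j|lebesgue. \<bar>g t\<bar> powr p)) / 2 ^ n"
    by (intro divide_right_mono sum_mono avg_powr_le[OF p g int]) simp
  also have "\<dots> = (\<Sum>j<2 ^ n. LINT t|lebesgue. indicator (dyadic_ivl n j) t * \<bar>g t\<bar> powr p)"
    by (simp add: sum_divide_distrib set_lebesgue_integral_def)
  also have "\<dots> = (LINT t|lebesgue. (\<Sum>j<2 ^ n. indicator (dyadic_ivl n j) t * \<bar>g t\<bar> powr p))"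
    using set_integrable_dyadic[OF Lp_integrable[OF g], of n]
    by (intro Bochner_Integration.integral_sum[symmetric]) (simp add: set_integrable_def)
  also have "\<dots> \<le> Lp_int p g"
    unfolding Lp_int_def
  proof (intro integral_mono Lp_integrable g Bochner_Integration.integrable_sum)
    show "integrable lebesgue (\<lambda>t. indicator (dyadic_ivl n j) t * \<bar>g t\<bar> powr p)" for j
      using set_integrable_dyadic[OF Lp_integrable[OF g], of n] by (simp add: set_integrable_def)
    fix t :: real
    have "(\<Sum>j<2 ^ n. indicator (dyadic_ivl n j) t * \<bar>g t\<bar> powr p)
        \<le> (\<Sum>j<2 ^ n. if j = dyadic_idx n t then \<bar>g t\<bar> powr p else 0)"
      by (intro sum_mono) (auto simp: indicator_def dyadic_ivl_iff)
    also have "\<dots> \<le> \<bar>g t\<bar> powr p" by simp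
    finally show "(\<Sum>j<2 ^ n. indicator (dyadic_ivl n j) t * \<bar>g t\<bar> powr p) \<le> \<bar>g t\<bar> powr p" .
  qed
  finally show ?thesis by (simp add: cond_avg_int)
qed


lemma avg_linear_diff:
  assumes "integrable lebesgue g" "integrable lebesgue h"
  shows "avg (\<lambda>x. g x - h x) n j = avg g n j - avg h n j"
  using avg_linear[OF assms, of 1 "-1"] by simp

lemma integrable_cond_avg: "integrable lebesgue (cond_avg g n)"
  using has_integral_dyadic_step(1)[of "avg g n" n]
  by (simp add: set_integrable_def cond_avg_def[abs_def])

text \<open>The tower property, by descending induction from level m: averages over parents are
  determined by those over their halves.\<close>

lemma avg_cond_avg:
  assumes g: "integrable lebesgue g" and nm: "n \<le> m"
  shows "j < 2 ^ n \<Longrightarrow> avg (cond_avg g m) n j = avg g n j"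
  using nm
proof (induction n arbitrary: j rule: inc_induct)
  case base
  have "(LINT t:dyadic_ivl m j|lebesgue. cond_avg g m t) = (LINT t:dyadic_ivl m j|lebesgue. avg g m j)"
    using dyadic_ivl_subset[OF base]
    by (intro set_lebesgue_integral_cong) (auto simp: cond_avg_def dyadic_ivl_iff)
  then show ?case unfolding avg_def[of "cond_avg g m"] set_integral_dyadic_const by simp
next
  case (step n)
  then show ?case
    using step.IH[of "2 * j"] step.IH[of "2 * j + 1"]
    by (simp add: avg_split[OF g, of n j] avg_split[OF integrable_cond_avg, of g m n j])
qed

lemma set_integral_initial_dyadic:
  assumes g: "integrable lebesgue g" and z: "\<And>j. j < 2 ^ n \<Longrightarrow> avg g n j = 0"
  shows "k \<le> 2 ^ n \<Longrightarrow> (LINT t:{0..<real k / 2 ^ n}|lebesgue. g t) = 0"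
proof (induction k)
  case (Suc k)
  have eq: "{0..<real (Suc k) / 2 ^ n} = {0..<real k / 2 ^ n} \<union> dyadic_ivl n k"
    unfolding dyadic_ivl_def by (subst ivl_disj_un_two(3)) (auto simp: add.commute divide_right_mono)
  have disj: "{0..<real k / 2 ^ n} \<inter> dyadic_ivl n k = {}" by (auto simp: dyadic_ivl_def)
  have "set_integrable lebesgue {0..<real k / 2 ^ n} g"
    unfolding set_integrable_def by (rule integrable_mult_indicator[OF _ g]) simp
  then have "(LINT t:{0..<real (Suc k) / 2 ^ n}|lebesgue. g t)
      = (LINT t:{0..<real k / 2 ^ n}|lebesgue. g t) + (LINT t:dyadic_ivl n k|lebesgue. g t)"
    unfolding eq by (rule set_integral_Un[OF disj _ set_integrable_dyadic[OF g]])
  moreover have "(LINT t:dyadic_ivl n k|lebesgue. g t) = 0"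
    using z[of k] Suc.prems by (simp add: avg_def)
  ultimately show ?case using Suc by simp
qed (simp add: set_lebesgue_integral_def)

lemma dyadic_approx_tendsto:
  "(\<lambda>n. real (dyadic_idx n x) / 2 ^ n) \<longlonglongrightarrow> x" and dyadic_approx_le: "real (dyadic_idx n x) / 2 ^ n \<le> x"
  if "0 \<le> x"
proof -
  have *: "real (dyadic_idx n x) = \<lfloor>2 ^ n * x\<rfloor>" for n
    using that by (simp add: dyadic_idx_def)
  have up: "real (dyadic_idx n x) / 2 ^ n \<le> x" for n
    unfolding * by (simp add: field_simps)
  then show "real (dyadic_idx n x) / 2 ^ n \<le> x" .
  have lo: "x - (1 / 2) ^ n \<le> real (dyadic_idx n x) / 2 ^ n" for n
  proof -
    have "2 ^ n * x - 1 \<le> real (dyadic_idx n x)" unfolding * by linarith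
    then have "(2 ^ n * x - 1) / 2 ^ n \<le> real (dyadic_idx n x) / 2 ^ n" by (intro divide_right_mono) auto
    then show ?thesis by (simp add: diff_divide_distrib power_one_over)
  qed
  have lim: "(\<lambda>n. x - (1 / 2) ^ n) \<longlonglongrightarrow> x"
    using tendsto_diff[OF tendsto_const LIMSEQ_power_zero[of "1 / 2 :: real"], of x] by simp
  show "(\<lambda>n. real (dyadic_idx n x) / 2 ^ n) \<longlonglongrightarrow> x"
    by (rule tendsto_sandwich[OF always_eventually always_eventually lim tendsto_const]) (use lo up in blast)+
qed

text \<open>Inside [0,1) the endpoint x is approached from below by dyadic rationals, for which the
  integral is a sum of vanishing averages; dominated convergence gives x itself. The rays are open
  at x so that each t < x is eventually covered.\<close>

lemma set_integral_lessThan_zero: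
  assumes g: "integrable lebesgue g" and supp: "\<And>x. x \<notin> {0..<1} \<Longrightarrow> g x = 0"
    and z: "\<And>n j. j < 2 ^ n \<Longrightarrow> avg g n j = 0"
  shows "(LINT t:{..<x}|lebesgue. g t) = 0"
proof (cases "0 \<le> x \<and> x < 1")
  case True
  define X where "X = (\<lambda>n. real (dyadic_idx n x) / 2 ^ n)"
  have X: "X \<longlonglongrightarrow> x" "\<And>n. X n \<le> x" "\<And>n. 0 \<le> X n"
    using dyadic_approx_tendsto[of x] dyadic_approx_le[of x] True by (auto simp: X_def)
  have Xz: "(LINT t:{0..<X n}|lebesgue. g t) = 0" for n
    unfolding X_def using dyadic_idx_less[of x n] True z
    by (intro set_integral_initial_dyadic[OF g]) auto
  have "(\<lambda>n. LINT t|lebesgue. indicator {0..<X n} t *\<^sub>R g t) \<longlonglongrightarrow> (LINT t|lebesgue. indicator {..<x} t *\<^sub>R g t)"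
  proof (rule integral_dominated_convergence[where w = "\<lambda>t. \<bar>g t\<bar>"])
    show "AE t in lebesgue. (\<lambda>n. indicator {0..<X n} t *\<^sub>R g t) \<longlonglongrightarrow> indicator {..<x} t *\<^sub>R g t"
    proof (rule AE_I2)
      fix t :: real
      show "(\<lambda>n. indicator {0..<X n} t *\<^sub>R g t) \<longlonglongrightarrow> indicator {..<x} t *\<^sub>R g t"
      proof (cases "0 \<le> t \<and> t < x")
        case tx: True
        then have "eventually (\<lambda>n. t < X n) sequentially" using X(1) by (intro order_tendstoD(1)) auto
        then have "eventually (\<lambda>n. indicator {0..<X n} t *\<^sub>R g t = indicator {..<x} t *\<^sub>R g t) sequentially"
          by eventually_elim (use tx in auto)
        then show ?thesis by (rule tendsto_eventually)
      next
        case False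
        have "indicator {0..<X n} t *\<^sub>R g t = indicator {..<x} t *\<^sub>R g t" for n
          using False X(2)[of n] supp[of t] by (auto simp: indicator_def)
        then show ?thesis by (simp only: tendsto_const)
      qed
    qed
    show "AE t in lebesgue. norm (indicator {0..<X n} t *\<^sub>R g t) \<le> \<bar>g t\<bar>" for n
      by (auto simp: indicator_def)
    show "integrable lebesgue (\<lambda>t. \<bar>g t\<bar>)" using g by simp
  qed (rule borel_measurable_integrable[OF integrable_mult_indicator[OF _ g]], simp)+
  then have "(\<lambda>n. 0) \<longlonglongrightarrow> (LINT t:{..<x}|lebesgue. g t)"
    using Xz by (simp only: set_lebesgue_integral_def)
  then show ?thesis by (simp add: LIMSEQ_const_iff)
next
  case False
  have "(LINT t:{..<x}|lebesgue. g t) = (if x < 0 then 0 else (LINT t:{0..<1}|lebesgue. g t))"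
  proof -
    have "indicator {..<x} t *\<^sub>R g t = (if x < 0 then 0 else indicator {0..<1} t *\<^sub>R g t)" for t
      using False supp[of t] by (auto simp: indicator_def)
    then show ?thesis by (simp add: set_lebesgue_integral_def)
  qed
  moreover have "(LINT t:{0..<1}|lebesgue. g t) = 0"
    using set_integral_initial_dyadic[OF g, of 0 1] z by simp
  ultimately show ?thesis by simp
qed

lemma sigma_finite_lebesgue: "sigma_finite_measure (lebesgue :: real measure)"
proof
  have "(\<Union>n::nat. {- real n..real n}) = UNIV"
  proof -
    have "\<exists>n::nat. x \<in> {- real n..real n}" for x :: real
    proof -
      obtain n :: nat where "\<bar>x\<bar> \<le> real n" using real_arch_simple by blast
      then have "x \<in> {- real n..real n}" by (simp add: abs_le_iff)
      then show ?thesis by blast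
    qed
    then show ?thesis by blast
  qed
  then have "\<Union> (range (\<lambda>n::nat. {- real n..real n})) = space lebesgue" by simp
  moreover have "range (\<lambda>n::nat. {- real n..real n}) \<subseteq> sets lebesgue" by (rule image_subsetI) simp
  moreover have "\<forall>a\<in>range (\<lambda>n::nat. {- real n..real n}). emeasure lebesgue a \<noteq> \<infinity>" by simp
  moreover have "countable (range (\<lambda>n::nat. {- real n..real n}))" by simp
  ultimately show "\<exists>A. countable A \<and> A \<subseteq> sets lebesgue \<and> \<Union> A = space lebesgue \<and>
      (\<forall>a\<in>(A :: real set set). emeasure lebesgue a \<noteq> \<infinity>)"
    by (intro exI conjI)
qed

text \<open>The rays form a generator of the Borel sets closed under intersection, and the sets with
  vanishing integral are closed under complements and disjoint unions, so g integrates to zero over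
  every Borel set, hence over every Lebesgue set.\<close>

lemma AE_zero_of_avg_zero:
  assumes g: "integrable lebesgue g" and supp: "\<And>x. x \<notin> {0..<1} \<Longrightarrow> g x = 0"
    and z: "\<And>n j. j < 2 ^ n \<Longrightarrow> avg g n j = 0"
  shows "AE x in lebesgue. g x = 0"
proof (rule sigma_finite_measure.density_zero[OF sigma_finite_lebesgue g])
  have si: "set_integrable lebesgue A g" if "A \<in> sets lebesgue" for A
    unfolding set_integrable_def by (rule integrable_mult_indicator[OF that g])
  have sets_borel_lessThan: "sets borel = sigma_sets UNIV (range (lessThan :: real \<Rightarrow> real set))"
    by (subst borel_Iio, rule sets_measure_of) simp
  have borel: "(LINT t:A|lebesgue. g t) = 0" if "A \<in> sets borel" for A
  proof -
    have A: "A \<in> sigma_sets UNIV (range lessThan)"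
      using that sets_borel_lessThan by blast
    have "Int_stable (range lessThan :: real set set)"
    proof (rule Int_stableI)
      fix A B :: "real set" assume "A \<in> range lessThan" "B \<in> range lessThan"
      then obtain a b where "A = {..<a}" "B = {..<b}" by blast
      then have "A \<inter> B = {..<min a b}" by auto
      then show "A \<inter> B \<in> range lessThan" by blast
    qed
    moreover have "range lessThan \<subseteq> Pow (UNIV :: real set)" by simp
    ultimately show ?thesis using A
    proof (induction rule: sigma_sets_induct_disjoint)
      case (basic A)
      then show ?case using set_integral_lessThan_zero[OF g supp z] by auto
    next
      case empty
      show ?case by (simp add: set_lebesgue_integral_def)
    next
      case (compl A)
      then have A: "A \<in> sets borel" using sets_borel_lessThan by blast
      have "(LINT t:UNIV|lebesgue. g t) = (LINT t:{0..<1}|lebesgue. g t)"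
        unfolding set_lebesgue_integral_def using supp
        by (intro Bochner_Integration.integral_cong) (auto simp: indicator_def)
      also have "\<dots> = 0" using set_integral_initial_dyadic[OF g, of 0 1] z by simp
      finally have "(LINT t:A \<union> - A|lebesgue. g t) = 0" by simp
      moreover have "(LINT t:A \<union> - A|lebesgue. g t) = (LINT t:A|lebesgue. g t) + (LINT t:-A|lebesgue. g t)"
        using A by (intro set_integral_Un si) auto
      ultimately show ?case using compl by (simp add: Compl_eq_Diff_UNIV)
    next
      case (union A)
      have "A i \<in> sets borel" for i using union(2) sets_borel_lessThan by blast
      then have A: "A i \<in> sets lebesgue" for i by simp
      have "(LINT t:(\<Union>i. A i)|lebesgue. g t) = (\<Sum>i. LINT t:A i|lebesgue. g t)"
        using A union(1) by (intro lebesgue_integral_countable_add si) (auto simp: disjoint_family_on_def)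
      then show ?case using union by simp
    qed
  qed
  \<comment> \<open>A Lebesgue set is a Borel set up to a subset of a null set, which does not
    affect the integral.\<close>
  fix A :: "real set" assume "A \<in> sets lebesgue"
  then obtain S N N' where A: "A = S \<union> N" "N \<subseteq> N'" "N' \<in> null_sets lborel" "S \<in> sets lborel"
    by (elim sets_completionE) blast
  have "AE t in lebesgue. t \<notin> N'"
    using A(3) by (intro AE_not_in) (simp add: null_sets_completionI)
  then have "AE t in lebesgue. indicator A t *\<^sub>R g t = indicator S t *\<^sub>R g t"
    by eventually_elim (use A in \<open>auto simp: indicator_def\<close>)
  then have "(LINT t:A|lebesgue. g t) = (LINT t:S|lebesgue. g t)"
    unfolding set_lebesgue_integral_def using \<open>A \<in> sets lebesgue\<close> A(4)
    by (intro integral_cong_AE borel_measurable_integrable[OF integrable_mult_indicator[OF _ g]]) auto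
  then show "(LINT t:A|lebesgue. g t) = 0" using borel[of S] A(4) by simp
qed

subsection \<open>Haar coefficients\<close>

text \<open>Nonnegativity of the left side forces q to increase; being bounded it converges, and its
  tail differences control those of G. It serves both for conditional expectations and for block
  sums.\<close>

lemma Lp_Cauchy_of_increments:
  fixes G :: "nat \<Rightarrow> real \<Rightarrow> real" and q :: "nat \<Rightarrow> real" and C B e :: real
  assumes C: "0 < C" and inc: "\<And>n m. n \<le> m \<Longrightarrow> Lp_int p (\<lambda>x. G m x - G n x) \<le> C * (q m - q n)"
    and bdd: "\<And>n. q n \<le> B" and e: "0 < e"
  shows "\<exists>N. \<forall>m\<ge>N. \<forall>n\<ge>N. Lp_int p (\<lambda>x. G m x - G n x) < e"
proof -
  have "q n \<le> q m" if "n \<le> m" for n m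
  proof -
    have "0 \<le> C * (q m - q n)" using inc[OF that] Lp_int_nonneg order_trans by blast
    then show ?thesis using C by (simp add: zero_le_mult_iff)
  qed
  then have "incseq q" by (simp add: incseq_def)
  then obtain L where L: "q \<longlonglongrightarrow> L" "\<forall>n. q n \<le> L"
    using incseq_convergent[of q B] bdd by blast
  have "0 < e / C" using C e by simp
  then have "\<forall>\<^sub>F n in sequentially. L - e / C < q n"
    using order_tendstoD(1)[OF L(1), of "L - e / C"] by simp
  then obtain N where N: "\<And>n. n \<ge> N \<Longrightarrow> L - e / C < q n"
    unfolding eventually_sequentially by blast
  have *: "Lp_int p (\<lambda>x. G m x - G n x) < e" if "N \<le> n" "n \<le> m" for n m
  proof -
    have "q m - q n < e / C" using N[OF that(1)] L(2)[rule_format, of m] by linarith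
    then have "C * (q m - q n) < e" using C by (simp add: field_simps)
    then show ?thesis using inc[OF that(2)] by linarith
  qed
  have "Lp_int p (\<lambda>x. G m x - G n x) < e" if "N \<le> n" "N \<le> m" for n m
    using *[of n m] *[of m n] that Lp_int_minus_commute[of p "G m" "G n"] by (cases "n \<le> m") auto
  then show ?thesis by blast
qed

lemma Lp_tendsto_bound:
  assumes p: "0 \<le> p" and h: "h \<in> Lp p" and G: "\<And>n. G n \<in> Lp p"
    and lim: "(\<lambda>n. Lp_int p (\<lambda>x. h x - G n x)) \<longlonglongrightarrow> 0" and B: "\<And>n. Lp_int p (G n) \<le> B"
  shows "Lp_int p h \<le> 2 powr p * B"
proof (rule tendsto_lowerbound)
  have "(\<lambda>n. 2 powr p * (Lp_int p (\<lambda>x. h x - G n x) + B)) \<longlonglongrightarrow> 2 powr p * (0 + B)"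
    by (intro tendsto_intros lim)
  then show "(\<lambda>n. 2 powr p * (Lp_int p (\<lambda>x. h x - G n x) + B)) \<longlonglongrightarrow> 2 powr p * B" by simp
  have "Lp_int p h \<le> 2 powr p * (Lp_int p (\<lambda>x. h x - G n x) + B)" for n
  proof -
    have "Lp_int p (\<lambda>x. (h x - G n x) + G n x) \<le> 2 powr p * (Lp_int p (\<lambda>x. h x - G n x) + Lp_int p (G n))"
      by (intro Lp_add(2) p Lp_diff(1) h G)
    also have "\<dots> \<le> 2 powr p * (Lp_int p (\<lambda>x. h x - G n x) + B)"
      by (intro mult_left_mono add_left_mono B) simp
    finally show ?thesis by simp
  qed
  then show "\<forall>\<^sub>F n in sequentially. Lp_int p h \<le> 2 powr p * (Lp_int p (\<lambda>x. h x - G n x) + B)"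
    by simp
qed simp

context haar_translates
begin

lemma Sq_atMost: "Sq {..n} d t = (d 0 (dyadic_idx 0 t))\<^sup>2 + (\<Sum>i<n. (d (Suc i) (dyadic_idx i t))\<^sup>2)"
  unfolding Sq_def by (simp add: sum.atMost_shift)

lemma Sq_greaterThanAtMost:
  "Sq {n<..m} d t = (\<Sum>i<m. (if n \<le> i then d (Suc i) (dyadic_idx i t) else 0)\<^sup>2)"
proof -
  have eq: "{n<..m} = Suc ` {n..<m}" by (simp add: atLeastLessThanSuc_atLeastAtMost atLeastSucAtMost_greaterThanAtMost)
  have "Sq {n<..m} d t = (\<Sum>i\<in>{n..<m}. (d (Suc i) (dyadic_idx i t))\<^sup>2)"
    unfolding Sq_def eq by (subst sum.reindex) auto
  also have "\<dots> = (\<Sum>i<m. (if n \<le> i then d (Suc i) (dyadic_idx i t) else 0)\<^sup>2)"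
    by (intro sum.mono_neutral_cong_left) auto
  finally show ?thesis .
qed

lemma Sq_int_atMost:
  "Sq_int {..n} (haar_coef g) = sq_int p (avg g 0 0) (\<lambda>i. haar_coef g (Suc i)) n"
proof -
  have eq: "indicator {0..<1} t *\<^sub>R (Sq {..n} (haar_coef g) t powr (p / 2)) =
    indicator {0..<1} t *\<^sub>R (((avg g 0 0)\<^sup>2 + (\<Sum>i<n. (haar_coef g (Suc i) (dyadic_idx i t))\<^sup>2)) powr (p / 2))" for t
    by (cases "t \<in> {0..<1::real}") (simp_all add: Sq_atMost dyadic_idx_0 haar_coef_def)
  show ?thesis unfolding Sq_int_def sq_int_def set_lebesgue_integral_def eq ..
qed

lemma Sq_int_greaterThanAtMost:
  "Sq_int {n<..m} d = sq_int p 0 (\<lambda>i j. if n \<le> i then d (Suc i) j else 0) m"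
  unfolding Sq_int_def sq_int_def Sq_greaterThanAtMost by simp

text \<open>Superadditivity of x^(p/2). It bounds a tail by a difference of two terms of a bounded
  increasing sequence, so partial sums are Cauchy.\<close>

lemma Sq_int_increment:
  assumes "n \<le> m"
  shows "Sq_int {n<..m} d \<le> Sq_int {..m} d - Sq_int {..n} d"
proof -
  have "Sq {..m} d t = Sq {..n} d t + Sq {n<..m} d t" for t
  proof -
    have "{..m} = {..n} \<union> {n<..m}" "{..n} \<inter> {n<..m} = {}" using assms by auto
    then show ?thesis unfolding Sq_def by (simp add: sum.union_disjoint)
  qed
  then have le: "Sq {n<..m} d t powr (p / 2) + Sq {..n} d t powr (p / 2) \<le> Sq {..m} d t powr (p / 2)" for t
    using powr_superadditive[of "p / 2" "Sq {n<..m} d t" "Sq {..n} d t"] p4 Sq_nonneg by (simp add: add.commute)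
  note int = sq_idx_set(2)[of _ d]
  have "Sq_int {n<..m} d + Sq_int {..n} d = (LINT t:{0..<1}|lebesgue. Sq {n<..m} d t powr (p / 2) + Sq {..n} d t powr (p / 2))"
    unfolding Sq_int_def by (intro set_integral_add(2)[symmetric] int) auto
  also have "\<dots> \<le> Sq_int {..m} d"
    unfolding Sq_int_def by (intro set_integral_mono set_integral_add(1) int le) auto
  finally show ?thesis by simp
qed

lemma avg_dyadic_idx:
  assumes "integrable lebesgue g" "t \<in> {0..<1}"
  shows "avg g n (dyadic_idx n t) = avg g 0 0 + (\<Sum>i<n. rad i t * haar_coef g (Suc i) (dyadic_idx i t))"
  using dyadic_mart_avg[OF assms(1) dyadic_idx_less[of t n]] assms(2) by (simp add: dyadic_mart_idx)

lemma cond_avg_mart: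
  assumes g: "integrable lebesgue g"
  shows "Lp_int p (cond_avg g n) = mart_int p (avg g 0 0) (\<lambda>i. haar_coef g (Suc i)) n"
proof -
  have "\<bar>cond_avg g n t\<bar> powr p = indicator {0..<1} t *\<^sub>R
      (\<bar>avg g 0 0 + (\<Sum>i<n. rad i t * haar_coef g (Suc i) (dyadic_idx i t))\<bar> powr p)" for t
    using avg_dyadic_idx[OF g, of t n] by (cases "t \<in> {0..<1::real}") (simp_all add: cond_avg_def)
  then show ?thesis by (simp add: Lp_int_def mart_int_def set_lebesgue_integral_def)
qed

lemma cond_avg_diff_mart:
  assumes g: "integrable lebesgue g" and nm: "n \<le> m"
  shows "Lp_int p (\<lambda>t. cond_avg g m t - cond_avg g n t)
    = mart_int p 0 (\<lambda>i j. if n \<le> i then haar_coef g (Suc i) j else 0) m"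
proof -
  have "\<bar>cond_avg g m t - cond_avg g n t\<bar> powr p = indicator {0..<1} t *\<^sub>R
      (\<bar>0 + (\<Sum>i<m. rad i t * (if n \<le> i then haar_coef g (Suc i) (dyadic_idx i t) else 0))\<bar> powr p)" for t
  proof (cases "t \<in> {0..<1::real}")
    case True
    let ?h = "\<lambda>i. rad i t * haar_coef g (Suc i) (dyadic_idx i t)"
    have "(\<Sum>i<m. ?h i) = (\<Sum>i<n. ?h i) + (\<Sum>i\<in>{n..<m}. ?h i)"
      using nm by (simp add: lessThan_atLeast0 sum.atLeastLessThan_concat)
    also have "(\<Sum>i\<in>{n..<m}. ?h i) = (\<Sum>i<m. rad i t * (if n \<le> i then haar_coef g (Suc i) (dyadic_idx i t) else 0))"
      by (intro sum.mono_neutral_cong_left) auto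
    finally show ?thesis using True avg_dyadic_idx[OF g True] by (simp add: cond_avg_def)
  qed (simp add: cond_avg_def)
  then show ?thesis by (simp add: Lp_int_def mart_int_def set_lebesgue_integral_def)
qed

text \<open>Identifies the limit of the conditional expectations: on each dyadic interval the limit
  has the same average as g, because averages are continuous in L_p and stop changing from that
  level on.\<close>

lemma cond_avg_limit:
  assumes g: "g \<in> Lp p" and supp: "\<And>x. x \<notin> {0..<1} \<Longrightarrow> g x = 0"
    and h: "h \<in> Lp p" and lim: "(\<lambda>n. Lp_int p (\<lambda>x. h x - cond_avg g n x)) \<longlonglongrightarrow> 0"
  shows "(\<lambda>n. Lp_int p (\<lambda>x. g x - cond_avg g n x)) \<longlonglongrightarrow> 0"
proof -
  have p1: "1 \<le> p" using p4 by simp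
  \<comment> \<open>The limit h is cut off outside [0,1), since \<open>AE_zero_of_avg_zero\<close>
    asks for support there; this only decreases the distance to the conditional
    expectations.\<close>
  define k where "k = (\<lambda>x. indicator {0..<1} x * h x)"
  have kL: "k \<in> Lp p"
  proof (rule LpI)
    show "k \<in> borel_measurable lebesgue" unfolding k_def
      by (intro borel_measurable_times borel_measurable_indicator Lp_measurable[OF h]) simp
    have "\<bar>k x\<bar> powr p = indicator {0..<1} x *\<^sub>R \<bar>h x\<bar> powr p" for x by (simp add: k_def indicator_def)
    then show "integrable lebesgue (\<lambda>x. \<bar>k x\<bar> powr p)"
      using integrable_mult_indicator[OF _ Lp_integrable[OF h], of "{0..<1}"] by simp
  qed
  have ksupp: "k x = 0" if "x \<notin> {0..<1}" for x using that by (simp add: k_def)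
  have gi: "integrable lebesgue g" and ki: "integrable lebesgue k"
    using Lp_imp_integrable[OF p1 g supp] Lp_imp_integrable[OF p1 kL ksupp] by auto
  note EL = cond_avg_Lp[of g _ p] and Ei = integrable_cond_avg[of g]
  have le: "Lp_int p (\<lambda>x. k x - cond_avg g n x) \<le> Lp_int p (\<lambda>x. h x - cond_avg g n x)" for n
    unfolding Lp_int_def
    using p4 by (intro integral_mono Lp_integrable Lp_diff(1) kL h EL) (auto simp: k_def cond_avg_def indicator_def)
  have klim: "(\<lambda>n. Lp_int p (\<lambda>x. k x - cond_avg g n x)) \<longlonglongrightarrow> 0"
    by (rule tendsto_sandwich[OF always_eventually always_eventually tendsto_const lim]) (use le in auto)
  have "avg (\<lambda>x. k x - g x) n j = 0" if j: "j < 2 ^ n" for n j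
  proof -
    have bound: "\<bar>avg (\<lambda>x. k x - g x) n j\<bar> powr p \<le> 2 ^ n * Lp_int p (\<lambda>x. k x - cond_avg g m x)" if "n \<le> m" for m
    proof -
      let ?D = "\<lambda>x. k x - cond_avg g m x"
      have DL: "?D \<in> Lp p" using p4 by (intro Lp_diff(1) kL EL) auto
      have Di: "integrable lebesgue ?D" by (intro Bochner_Integration.integrable_diff ki Ei)
      have "avg (\<lambda>x. k x - g x) n j = avg ?D n j"
        by (simp add: avg_linear_diff[OF ki gi] avg_linear_diff[OF ki Ei] avg_cond_avg[OF gi \<open>n \<le> m\<close> j])
      then have "\<bar>avg (\<lambda>x. k x - g x) n j\<bar> powr p \<le> 2 ^ n * (LINT t:dyadic_ivl n j|lebesgue. \<bar>?D t\<bar> powr p)"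
        using avg_powr_le[OF p1 DL Di, of n j] by simp
      also have "\<dots> \<le> 2 ^ n * Lp_int p ?D"
        unfolding Lp_int_def set_lebesgue_integral_def
        by (intro mult_left_mono integral_mono integrable_mult_indicator Lp_integrable[OF DL]) (auto simp: indicator_def)
      finally show ?thesis .
    qed
    have "\<bar>avg (\<lambda>x. k x - g x) n j\<bar> powr p \<le> 0"
    proof (rule tendsto_lowerbound)
      show "(\<lambda>m. 2 ^ n * Lp_int p (\<lambda>x. k x - cond_avg g m x)) \<longlonglongrightarrow> 0"
        using tendsto_mult_right_zero[OF klim] by simp
      show "\<forall>\<^sub>F m in sequentially. \<bar>avg (\<lambda>x. k x - g x) n j\<bar> powr p \<le> 2 ^ n * Lp_int p (\<lambda>x. k x - cond_avg g m x)"
        using bound by (auto simp: eventually_sequentially)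
    qed simp
    then show ?thesis by (simp add: not_less[symmetric])
  qed
  then have "AE x in lebesgue. k x - g x = 0"
    using ksupp supp ki gi by (intro AE_zero_of_avg_zero) auto
  then have "Lp_int p (\<lambda>x. g x - cond_avg g n x) = Lp_int p (\<lambda>x. k x - cond_avg g n x)" for n
    unfolding Lp_int_def using Lp_measurable[OF kL] Lp_measurable[OF g] Lp_measurable[OF EL]
    by (intro integral_cong_AE) auto
  then show ?thesis using klim by simp
qed

text \<open>Stated through bounds on all partial square functions, so that no infinite square
  function has to be formed. The first half combines Burkholder's inequality with contractivity of
  conditional expectations; the second uses that these converge to g.\<close>

theorem haar_coef_equiv:
  "\<exists>C>0. \<forall>g\<in>Lp p. (\<forall>x. x \<notin> {0..<1} \<longrightarrow> g x = 0) \<longrightarrow>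
    (\<forall>n. Sq_int {..n} (haar_coef g) \<le> C * Lp_int p g) \<and>
    (\<forall>B. (\<forall>n. Sq_int {..n} (haar_coef g) \<le> B) \<longrightarrow> Lp_int p g \<le> C * B)"
proof -
  obtain C where C: "C > 0" "\<And>a W n. mart_int p a W n \<le> C * sq_int p a W n \<and> sq_int p a W n \<le> C * mart_int p a W n"
    using square_function[OF p4] by metis
  define K where "K = C + 2 powr p * C"
  have K: "0 < K" "C \<le> K" "2 powr p * C \<le> K" using C(1) by (simp_all add: K_def add_pos_nonneg)
  have "(\<forall>n. Sq_int {..n} (haar_coef g) \<le> K * Lp_int p g) \<and>
    (\<forall>B. (\<forall>n. Sq_int {..n} (haar_coef g) \<le> B) \<longrightarrow> Lp_int p g \<le> K * B)"
    if g: "g \<in> Lp p" and supp: "\<And>x. x \<notin> {0..<1} \<Longrightarrow> g x = 0" for g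
  proof (intro conjI allI impI)
    have p1: "1 \<le> p" using p4 by simp
    have gi: "integrable lebesgue g" by (rule Lp_imp_integrable[OF p1 g supp])
    have up: "Sq_int {..n} (haar_coef g) \<le> C * Lp_int p g" for n
    proof -
      have "Sq_int {..n} (haar_coef g) \<le> C * Lp_int p (cond_avg g n)"
        using C(2) by (simp add: Sq_int_atMost cond_avg_mart[OF gi])
      also have "\<dots> \<le> C * Lp_int p g"
        using C(1) cond_avg_contraction[OF p1 g gi] by (intro mult_left_mono) auto
      finally show ?thesis .
    qed
    also have "C * Lp_int p g \<le> K * Lp_int p g" using K by (intro mult_right_mono) auto
    finally show "Sq_int {..n} (haar_coef g) \<le> K * Lp_int p g" for n by this
    have inc: "Lp_int p (\<lambda>t. cond_avg g m t - cond_avg g n t) \<le> C * (Sq_int {..m} (haar_coef g) - Sq_int {..n} (haar_coef g))"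
      if "n \<le> m" for n m
    proof -
      have "Lp_int p (\<lambda>t. cond_avg g m t - cond_avg g n t) \<le> C * Sq_int {n<..m} (haar_coef g)"
        using C(2) by (simp add: cond_avg_diff_mart[OF gi that] Sq_int_greaterThanAtMost)
      also have "\<dots> \<le> C * (Sq_int {..m} (haar_coef g) - Sq_int {..n} (haar_coef g))"
        using C(1) Sq_int_increment[OF that] by (intro mult_left_mono) auto
      finally show ?thesis .
    qed
    have "\<exists>h\<in>Lp p. (\<lambda>n. Lp_int p (\<lambda>x. h x - cond_avg g n x)) \<longlonglongrightarrow> 0"
      by (rule Lp_complete[OF cond_avg_Lp p Lp_Cauchy_of_increments[OF C(1) inc up]])
    then obtain h where "h \<in> Lp p" "(\<lambda>n. Lp_int p (\<lambda>x. h x - cond_avg g n x)) \<longlonglongrightarrow> 0"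
      by (elim bexE)
    then have lim: "(\<lambda>n. Lp_int p (\<lambda>x. g x - cond_avg g n x)) \<longlonglongrightarrow> 0"
      by (intro cond_avg_limit[OF g supp])
    fix B assume B: "\<forall>n. Sq_int {..n} (haar_coef g) \<le> B"
    have B0: "0 \<le> B" using B Sq_int_nonneg order_trans by blast
    have "Lp_int p (cond_avg g n) \<le> C * B" for n
    proof -
      have "Lp_int p (cond_avg g n) \<le> C * Sq_int {..n} (haar_coef g)"
        using C(2) by (simp add: Sq_int_atMost cond_avg_mart[OF gi])
      also have "\<dots> \<le> C * B" using B C(1) by (intro mult_left_mono) auto
      finally show ?thesis .
    qed
    then have "Lp_int p g \<le> 2 powr p * (C * B)"
      using p by (intro Lp_tendsto_bound[OF _ g cond_avg_Lp lim]) auto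
    also have "\<dots> = (2 powr p * C) * B" by simp
    also have "\<dots> \<le> K * B" using K(3) B0 by (intro mult_right_mono) auto
    finally show "Lp_int p g \<le> K * B" .
  qed
  then show ?thesis using K(1) by blast
qed

end

subsection \<open>Transport from the line to the unit interval\<close>

definition logit :: "real \<Rightarrow> real" where
  "logit t = ln t - ln (1 - t)"

text \<open>Composition with the bijection \<open>logit\<close> from (0,1) onto the line, times the
  p-th root of its derivative 1/(t (1 - t)), which makes the map isometric.\<close>

definition squeeze :: "real \<Rightarrow> (real \<Rightarrow> real) \<Rightarrow> real \<Rightarrow> real" where
  "squeeze p g t = indicator {0<..<1} t * (g (logit t) * (1 / (t * (1 - t))) powr (1 / p))"

lemma logit_deriv:
  assumes "t \<in> {0<..<1}"
  shows "(logit has_field_derivative 1 / (t * (1 - t))) (at t within {0<..<1})"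
proof -
  have "(logit has_field_derivative 1 / t - (0 - 1) / (1 - t)) (at t within {0<..<1})"
    unfolding logit_def[abs_def] using assms by (auto intro!: derivative_eq_intros)
  moreover have "1 / t - (0 - 1) / (1 - t) = 1 / (t * (1 - t))"
    using assms by (simp add: field_simps)
  ultimately show ?thesis by simp
qed

lemma logit_inverse:
  assumes "t \<in> {0<..<1}"
  shows "exp (logit t) / (1 + exp (logit t)) = t"
proof -
  have "exp (logit t) = t / (1 - t)" using assms by (simp add: logit_def exp_diff)
  moreover have "1 + t / (1 - t) = 1 / (1 - t)" using assms by (simp add: field_simps)
  ultimately show ?thesis using assms by simp
qed

lemma inj_logit: "inj_on logit {0<..<1}"
  by (metis inj_onI logit_inverse)

lemma logit_image: "logit ` {0<..<1} = UNIV"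
proof -
  have "x \<in> logit ` {0<..<1}" for x
  proof -
    define t where "t = exp x / (1 + exp x)"
    have pos: "0 < 1 + exp x" by (simp add: add_pos_pos)
    have t: "t \<in> {0<..<1}" using pos by (simp add: t_def)
    have "1 - t = 1 / (1 + exp x)" using pos by (simp add: t_def field_simps)
    then have "logit t = x" using pos by (simp add: logit_def t_def ln_div)
    then show ?thesis using t by (metis imageI)
  qed
  then show ?thesis by blast
qed

lemma logit_change_of_variables:
  fixes F :: "real \<Rightarrow> real"
  assumes F: "integrable lebesgue F"
  shows "set_integrable lebesgue {0<..<1} (\<lambda>t. 1 / (t * (1 - t)) * F (logit t))"
    and "(LINT t:{0<..<1}|lebesgue. 1 / (t * (1 - t)) * F (logit t)) = (LINT x|lebesgue. F x)"
proof -
  have ai: "F absolutely_integrable_on UNIV" using F by (simp add: set_integrable_def)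
  have iff: "((\<lambda>t. \<bar>1 / (t * (1 - t))\<bar> * F (logit t)) absolutely_integrable_on {0<..<1} \<and>
      integral {0<..<1} (\<lambda>t. \<bar>1 / (t * (1 - t))\<bar> * F (logit t)) = integral UNIV F)"
    using has_absolute_integral_change_of_variables_1'[OF _ logit_deriv inj_logit, of F "integral UNIV F"] ai
    by (simp add: logit_image)
  have eq: "indicator {0<..<1} t *\<^sub>R (\<bar>1 / (t * (1 - t))\<bar> * F (logit t)) = indicator {0<..<1} t *\<^sub>R (1 / (t * (1 - t)) * F (logit t))" for t :: real
    by (auto simp: indicator_def abs_mult)
  have si: "set_integrable lebesgue {0<..<1} (\<lambda>t. \<bar>1 / (t * (1 - t))\<bar> * F (logit t))" using iff by blast
  then show "set_integrable lebesgue {0<..<1} (\<lambda>t. 1 / (t * (1 - t)) * F (logit t))"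
    unfolding set_integrable_def eq .
  have "(LINT t:{0<..<1}|lebesgue. \<bar>1 / (t * (1 - t))\<bar> * F (logit t)) = integral UNIV F"
    using set_lebesgue_integral_eq_integral(2)[OF si] iff by simp
  also have "integral UNIV F = (LINT x|lebesgue. F x)"
    using set_lebesgue_integral_eq_integral(2)[OF ai] by (simp add: set_lebesgue_integral_def)
  finally show "(LINT t:{0<..<1}|lebesgue. 1 / (t * (1 - t)) * F (logit t)) = (LINT x|lebesgue. F x)"
    unfolding set_lebesgue_integral_def eq .
qed

lemma squeeze_supp: "t \<notin> {0..<1} \<Longrightarrow> squeeze p g t = 0"
  by (auto simp: squeeze_def indicator_def)

lemma squeeze_linear:
  "squeeze p (\<lambda>y. a * g y + b * h y) = (\<lambda>t. a * squeeze p g t + b * squeeze p h t)"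
  by (simp add: squeeze_def fun_eq_iff algebra_simps)

lemma squeeze_Lp:
  assumes p: "0 < p" and g: "g \<in> Lp p"
  shows "squeeze p g \<in> Lp p" and "Lp_int p (squeeze p g) = Lp_int p g"
proof -
  note [measurable] = Lp_measurable[OF g]
  let ?J = "\<lambda>t::real. 1 / (t * (1 - t))"
  have J: "0 < ?J t" if "t \<in> {0<..<1}" for t using that by simp
  have eq: "\<bar>squeeze p g t\<bar> powr p = indicator {0<..<1} t *\<^sub>R (?J t * \<bar>g (logit t)\<bar> powr p)" for t
  proof (cases "t \<in> {0<..<1}")
    case True
    then have "(?J t powr (1 / p)) powr p = ?J t" using p by (simp add: powr_powr)
    then show ?thesis using True p by (simp add: squeeze_def abs_mult powr_mult mult.commute)
  qed (simp add: squeeze_def)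
  \<comment> \<open>Composing a Lebesgue measurable function with \<open>logit\<close> raises a
    measurability question. The change of variables for the integrable signed power
    \<open>?F\<close> answers it, and a signed p-th root recovers
    \<open>squeeze p g\<close>.\<close>
  let ?F = "\<lambda>x. sgn (g x) * \<bar>g x\<bar> powr p"
  have "integrable lebesgue ?F"
    by (rule Bochner_Integration.integrable_bound[OF Lp_integrable[OF g]]) (auto simp: abs_mult abs_sgn_eq)
  from logit_change_of_variables(1)[OF this]
  have "(\<lambda>t. indicator {0<..<1} t *\<^sub>R (?J t * ?F (logit t))) \<in> borel_measurable lebesgue" (is "?G \<in> _")
    unfolding set_integrable_def by (rule borel_measurable_integrable)
  then have "(\<lambda>t. sgn (?G t) * \<bar>?G t\<bar> powr (1 / p)) \<in> borel_measurable lebesgue" by measurable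
  moreover have "sgn (?G t) * \<bar>?G t\<bar> powr (1 / p) = squeeze p g t" for t
  proof (cases "t \<in> {0<..<1} \<and> g (logit t) \<noteq> 0")
    case True
    then have Jt: "0 < ?J t" using J by blast
    have a: "\<bar>?G t\<bar> = ?J t * \<bar>g (logit t)\<bar> powr p"
      using True Jt by (simp add: abs_mult abs_sgn_eq)
    have "\<bar>?G t\<bar> powr (1 / p) = ?J t powr (1 / p) * (\<bar>g (logit t)\<bar> powr p) powr (1 / p)"
      unfolding a by (rule powr_mult)
    also have "(\<bar>g (logit t)\<bar> powr p) powr (1 / p) = \<bar>g (logit t)\<bar>"
      using p by (simp add: powr_powr)
    finally have 1: "\<bar>?G t\<bar> powr (1 / p) = ?J t powr (1 / p) * \<bar>g (logit t)\<bar>" .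
    have 2: "sgn (?G t) = sgn (g (logit t))"
      using True Jt by (simp add: sgn_mult)
    have "sgn (?G t) * \<bar>?G t\<bar> powr (1 / p) = (\<bar>g (logit t)\<bar> * sgn (g (logit t))) * ?J t powr (1 / p)"
      unfolding 1 2 by (simp only: mult_ac)
    also have "\<dots> = squeeze p g t"
      using True by (simp add: squeeze_def abs_mult_sgn)
    finally show ?thesis .
  qed (auto simp: squeeze_def)
  ultimately have m: "squeeze p g \<in> borel_measurable lebesgue" by simp
  show "squeeze p g \<in> Lp p"
    using logit_change_of_variables(1)[OF Lp_integrable[OF g]]
    by (intro LpI[OF m]) (simp only: eq set_integrable_def)
  show "Lp_int p (squeeze p g) = Lp_int p g"
    using logit_change_of_variables(2)[OF Lp_integrable[OF g]]
    unfolding Lp_int_def eq set_lebesgue_integral_def .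
qed

subsection \<open>The embedding\<close>

lemma Lp_norm_mono:
  assumes p: "0 < p" and C: "0 \<le> C" and le: "Lp_int p g \<le> C * Lp_int p h"
  shows "Lp_norm p g \<le> C powr (1 / p) * Lp_norm p h"
proof -
  have "Lp_int p g powr (1 / p) \<le> (C * Lp_int p h) powr (1 / p)"
    using p le by (intro powr_mono2) auto
  then show ?thesis by (simp add: Lp_norm_eq powr_mult)
qed

context haar_translates
begin

lemma Z_sum:
  assumes "finite L"
  shows "Z L d x = (\<Sum>l\<in>L. \<Sum>j<2 ^ (l - 1). \<Sum>s<block p (prod_encode (l, j)).
    coef d (enc l j s) * f (x - 3 ^ enc l j s))"
  unfolding Z_def by (rule sum_idx_set[OF assms])

lemma Z_diff: "n \<le> m \<Longrightarrow> Z {..m} d x - Z {..n} d x = Z {n<..m} d x"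
proof -
  assume nm: "n \<le> m"
  have "{..m} = {..n} \<union> {n<..m}" "{..n} \<inter> {n<..m} = {}" using nm by auto
  then show ?thesis by (simp add: Z_sum sum.union_disjoint)
qed

lemma coef_linear: "coef (\<lambda>l j. a * d l j + b * e l j) i = a * coef d i + b * coef e i"
  by (simp add: coef_def algebra_simps split: prod.split)

lemma Z_linear: "Z L (\<lambda>l j. a * d l j + b * e l j) x = a * Z L d x + b * Z L e x"
  unfolding Z_def coef_linear by (simp add: sum_distrib_left sum.distrib algebra_simps)

definition coords :: "(real \<Rightarrow> real) \<Rightarrow> nat \<Rightarrow> nat \<Rightarrow> real" where
  "coords g = haar_coef (squeeze p g)"

text \<open>The limit of the block sums is chosen as a function, not as a class, so linearity can
  hold only up to norm zero, which is what \<open>contains_copy_of_Lp\<close> asks for.\<close>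

definition T :: "(real \<Rightarrow> real) \<Rightarrow> real \<Rightarrow> real" where
  "T g = (SOME h. h \<in> Lp p \<and> (\<lambda>n. Lp_int p (\<lambda>x. h x - Z {..n} (coords g) x)) \<longlonglongrightarrow> 0)"

lemma coords_bounds:
  "\<exists>C>0. \<forall>g\<in>Lp p. (\<forall>n. Sq_int {..n} (coords g) \<le> C * Lp_int p g) \<and>
    (\<forall>B. (\<forall>n. Sq_int {..n} (coords g) \<le> B) \<longrightarrow> Lp_int p g \<le> C * B)"
proof -
  obtain C where C: "C > 0" "\<forall>g\<in>Lp p. (\<forall>x. x \<notin> {0..<1} \<longrightarrow> g x = 0) \<longrightarrow>
    (\<forall>n. Sq_int {..n} (haar_coef g) \<le> C * Lp_int p g) \<and>
    (\<forall>B. (\<forall>n. Sq_int {..n} (haar_coef g) \<le> B) \<longrightarrow> Lp_int p g \<le> C * B)"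
    using haar_coef_equiv by (elim exE conjE)
  have "(\<forall>n. Sq_int {..n} (coords g) \<le> C * Lp_int p g) \<and>
    (\<forall>B. (\<forall>n. Sq_int {..n} (coords g) \<le> B) \<longrightarrow> Lp_int p g \<le> C * B)" if g: "g \<in> Lp p" for g
    using C(2)[rule_format, OF squeeze_Lp(1)[OF p g] squeeze_supp]
    unfolding squeeze_Lp(2)[OF p g] coords_def .
  then show ?thesis using C(1) by (intro exI[of _ C]) simp
qed

lemma T_spec:
  assumes g: "g \<in> Lp p"
  shows "T g \<in> Lp p" and "(\<lambda>n. Lp_int p (\<lambda>x. T g x - Z {..n} (coords g) x)) \<longlonglongrightarrow> 0"
proof -
  obtain K where K: "K > 0" "\<And>L d. finite L \<Longrightarrow> Lp_int p (Z L d) \<le> K * Sq_int L d"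
    using Z_equiv by metis
  obtain C where C: "\<And>n. Sq_int {..n} (coords g) \<le> C * Lp_int p g"
    using coords_bounds g by metis
  have inc: "Lp_int p (\<lambda>x. Z {..m} (coords g) x - Z {..n} (coords g) x)
      \<le> K * (Sq_int {..m} (coords g) - Sq_int {..n} (coords g))" if "n \<le> m" for n m
  proof -
    have "Lp_int p (Z {n<..m} (coords g)) \<le> K * Sq_int {n<..m} (coords g)" by (rule K(2)) simp
    also have "\<dots> \<le> K * (Sq_int {..m} (coords g) - Sq_int {..n} (coords g))"
      using K(1) Sq_int_increment[OF that] by (intro mult_left_mono) auto
    finally show ?thesis by (simp add: Z_diff[OF that])
  qed
  have "\<exists>h\<in>Lp p. (\<lambda>n. Lp_int p (\<lambda>x. h x - Z {..n} (coords g) x)) \<longlonglongrightarrow> 0"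
    by (rule Lp_complete[OF Z_Lp p Lp_Cauchy_of_increments[OF K(1) inc C]])
  then have "\<exists>h. h \<in> Lp p \<and> (\<lambda>n. Lp_int p (\<lambda>x. h x - Z {..n} (coords g) x)) \<longlonglongrightarrow> 0"
    by (simp add: Bex_def)
  from someI_ex[OF this]
  show "T g \<in> Lp p" and "(\<lambda>n. Lp_int p (\<lambda>x. T g x - Z {..n} (coords g) x)) \<longlonglongrightarrow> 0"
    unfolding T_def by blast+
qed

lemma T_bounds:
  "\<exists>C>0. \<forall>g\<in>Lp p. Lp_int p (T g) \<le> C * Lp_int p g \<and> Lp_int p g \<le> C * Lp_int p (T g)"
proof -
  obtain K where K: "K > 0" "\<And>L d. finite L \<Longrightarrow> Lp_int p (Z L d) \<le> K * Sq_int L d"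
    "\<And>L d. finite L \<Longrightarrow> Sq_int L d \<le> K * Lp_int p (Z L d)"
    using Z_equiv by metis
  obtain C where C: "C > 0" "\<And>g n. g \<in> Lp p \<Longrightarrow> Sq_int {..n} (coords g) \<le> C * Lp_int p g"
    "\<And>g B. g \<in> Lp p \<Longrightarrow> (\<And>n. Sq_int {..n} (coords g) \<le> B) \<Longrightarrow> Lp_int p g \<le> C * B"
    using coords_bounds by metis
  define M where "M = C * (K * 2 powr p)"
  have "Lp_int p (T g) \<le> M * Lp_int p g \<and> Lp_int p g \<le> M * Lp_int p (T g)" if g: "g \<in> Lp p" for g
  proof
    note lim = T_spec(2)[OF g]
    have "Lp_int p (Z {..n} (coords g)) \<le> K * (C * Lp_int p g)" for n
    proof -
      have "Lp_int p (Z {..n} (coords g)) \<le> K * Sq_int {..n} (coords g)" by (rule K(2)) simp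
      also have "\<dots> \<le> K * (C * Lp_int p g)" using K(1) C(2)[OF g] by (intro mult_left_mono) auto
      finally show ?thesis .
    qed
    then have "Lp_int p (T g) \<le> 2 powr p * (K * (C * Lp_int p g))"
      using p by (intro Lp_tendsto_bound[OF _ T_spec(1)[OF g] Z_Lp lim]) auto
    then show "Lp_int p (T g) \<le> M * Lp_int p g" by (simp add: M_def mult_ac)
    \<comment> \<open>For fixed n the square function may be enlarged to any m >= n and then
      compared with the block sum at m; letting m grow replaces that sum by \<open>T g\<close>. The
      bound, free of n, is the B of \<open>coords_bounds\<close>.\<close>
    have "Sq_int {..n} (coords g) \<le> K * (2 powr p * (0 + Lp_int p (T g)))" for n
    proof (rule tendsto_lowerbound)
      show "(\<lambda>m. K * (2 powr p * (Lp_int p (\<lambda>x. T g x - Z {..m} (coords g) x) + Lp_int p (T g))))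
          \<longlonglongrightarrow> K * (2 powr p * (0 + Lp_int p (T g)))"
        by (intro tendsto_intros lim)
      have "Sq_int {..n} (coords g) \<le> K * (2 powr p * (Lp_int p (\<lambda>x. T g x - Z {..m} (coords g) x) + Lp_int p (T g)))"
        if nm: "n \<le> m" for m
      proof -
        have "Sq_int {..n} (coords g) \<le> Sq_int {..m} (coords g)"
          using Sq_int_increment[OF nm, of "coords g"] Sq_int_nonneg[of "{n<..m}" "coords g"] by linarith
        also have "\<dots> \<le> K * Lp_int p (Z {..m} (coords g))" by (rule K(3)) simp
        also have "Lp_int p (Z {..m} (coords g)) \<le> 2 powr p * (Lp_int p (\<lambda>x. Z {..m} (coords g) x - T g x) + Lp_int p (T g))"
          using Lp_add(2)[OF less_imp_le[OF p] Lp_diff(1)[OF less_imp_le[OF p] Z_Lp T_spec(1)[OF g]] T_spec(1)[OF g], of "{..m}" "coords g"]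
          by simp
        finally show ?thesis using K(1) by (simp add: Lp_int_minus_commute[of p "T g"])
      qed
      then show "\<forall>\<^sub>F m in sequentially. Sq_int {..n} (coords g)
          \<le> K * (2 powr p * (Lp_int p (\<lambda>x. T g x - Z {..m} (coords g) x) + Lp_int p (T g)))"
        unfolding eventually_sequentially by blast
    qed simp
    from C(3)[OF g this] show "Lp_int p g \<le> M * Lp_int p (T g)"
      by (simp add: M_def mult_ac)
  qed
  moreover have "M > 0" using K(1) C(1) by (simp add: M_def)
  ultimately show ?thesis by blast
qed

lemma coords_linear:
  assumes "g \<in> Lp p" "h \<in> Lp p"
  shows "coords (\<lambda>y. a * g y + b * h y) = (\<lambda>l j. a * coords g l j + b * coords h l j)"
proof -
  have p1: "1 \<le> p" using p4 by simp
  have "integrable lebesgue (squeeze p g)" "integrable lebesgue (squeeze p h)"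
    by (intro Lp_imp_integrable[OF p1] squeeze_Lp(1)[OF p] assms squeeze_supp; assumption)+
  then show ?thesis by (simp add: coords_def squeeze_linear haar_coef_linear fun_eq_iff)
qed

text \<open>The block sums are exactly linear in g, so the defect of linearity is a combination of
  the three approximation errors, for every n, and these tend to zero.\<close>

lemma T_linear:
  assumes g: "g \<in> Lp p" and h: "h \<in> Lp p"
  shows "Lp_int p (\<lambda>x. T (\<lambda>y. a * g y + b * h y) x - (a * T g x + b * T h x)) = 0"
proof -
  have p0: "0 \<le> p" using p by simp
  define k where "k = (\<lambda>y. a * g y + b * h y)"
  have k: "k \<in> Lp p" unfolding k_def by (intro Lp_add(1) p0 Lp_scale(1) g h)
  define E where "E = (\<lambda>g n x. T g x - Z {..n} (coords g) x)"
  have EL: "E g n \<in> Lp p" if "g \<in> Lp p" for g n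
    unfolding E_def by (intro Lp_diff(1) p0 T_spec(1) that Z_Lp)
  have lim: "(\<lambda>n. Lp_int p (E g n)) \<longlonglongrightarrow> 0" if "g \<in> Lp p" for g
    unfolding E_def by (rule T_spec(2)[OF that])
  have "Lp_int p (\<lambda>x. T k x - (a * T g x + b * T h x))
      \<le> 2 powr p * (Lp_int p (E k n) + 2 powr p * (\<bar>a\<bar> powr p * Lp_int p (E g n) + \<bar>b\<bar> powr p * Lp_int p (E h n)))" for n
  proof -
    have "T k x - (a * T g x + b * T h x) = E k n x - (a * E g n x + b * E h n x)" for x
      unfolding E_def k_def coords_linear[OF g h] Z_linear by (simp add: algebra_simps)
    then have "Lp_int p (\<lambda>x. T k x - (a * T g x + b * T h x)) = Lp_int p (\<lambda>x. E k n x - (a * E g n x + b * E h n x))"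
      by simp
    also have "\<dots> \<le> 2 powr p * (Lp_int p (E k n) + Lp_int p (\<lambda>x. a * E g n x + b * E h n x))"
      by (intro Lp_diff(2) Lp_add(1) Lp_scale(1) p0 EL g h k)
    also have "Lp_int p (\<lambda>x. a * E g n x + b * E h n x)
        \<le> 2 powr p * (Lp_int p (\<lambda>x. a * E g n x) + Lp_int p (\<lambda>x. b * E h n x))"
      by (intro Lp_add(2) Lp_scale(1) p0 EL g h)
    finally show ?thesis by (simp add: Lp_scale(2)[OF EL[OF g]] Lp_scale(2)[OF EL[OF h]])
  qed
  note ub = this
  have "(\<lambda>n. 2 powr p * (Lp_int p (E k n) + 2 powr p * (\<bar>a\<bar> powr p * Lp_int p (E g n) + \<bar>b\<bar> powr p * Lp_int p (E h n))))
      \<longlonglongrightarrow> 2 powr p * (0 + 2 powr p * (\<bar>a\<bar> powr p * 0 + \<bar>b\<bar> powr p * 0))"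
    by (intro tendsto_intros lim g h k)
  from tendsto_lowerbound[OF this always_eventually[OF allI[OF ub]]]
  have "Lp_int p (\<lambda>x. T k x - (a * T g x + b * T h x)) \<le> 0" by simp
  then show ?thesis by (simp add: k_def antisym)
qed

lemma T_Xp:
  assumes g: "g \<in> Lp p"
  shows "T g \<in> Xp p f \<Lambda>"
proof -
  have "\<exists>F a. finite F \<and> F \<subseteq> \<Lambda> \<and> Lp_norm p (\<lambda>x. T g x - lin_comb f F a x) < e" if e: "0 < e" for e
  proof -
    have "\<forall>\<^sub>F n in sequentially. Lp_int p (\<lambda>x. T g x - Z {..n} (coords g) x) < e powr p"
      using order_tendstoD(2)[OF T_spec(2)[OF g], of "e powr p"] e by simp
    then obtain n where "Lp_int p (\<lambda>x. T g x - Z {..n} (coords g) x) < e powr p"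
      unfolding eventually_sequentially by blast
    then have "Lp_norm p (\<lambda>x. T g x - Z {..n} (coords g) x) < e"
      using p e by (simp add: Lp_norm_less_iff)
    moreover have "finite ((\<lambda>i. (3::int) ^ i) ` idx_set {..n})" by (simp add: finite_idx_set)
    moreover have "(\<lambda>i. (3::int) ^ i) ` idx_set {..n} \<subseteq> \<Lambda>" by (auto simp: \<Lambda>_def)
    ultimately show ?thesis unfolding Z_lin_comb by blast
  qed
  then show ?thesis using T_spec(1)[OF g] by (simp add: Xp_def)
qed

theorem contains_copy: "contains_copy_of_Lp p (Xp p f \<Lambda>)"
proof -
  obtain C where C: "C > 0" "\<And>g. g \<in> Lp p \<Longrightarrow> Lp_int p (T g) \<le> C * Lp_int p g"
    "\<And>g. g \<in> Lp p \<Longrightarrow> Lp_int p g \<le> C * Lp_int p (T g)"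
    using T_bounds by metis
  define D where "D = C powr (1 / p)"
  have D: "0 < D" using C(1) by (simp add: D_def)
  have up: "Lp_norm p (T g) \<le> D * Lp_norm p g" if "g \<in> Lp p" for g
    unfolding D_def using C(1) C(2)[OF that] p by (intro Lp_norm_mono) auto
  have lo: "1 / D * Lp_norm p g \<le> Lp_norm p (T g)" if "g \<in> Lp p" for g
  proof -
    have "Lp_norm p g \<le> D * Lp_norm p (T g)"
      unfolding D_def using C(1) C(3)[OF that] p by (intro Lp_norm_mono) auto
    then show ?thesis using D by (simp add: field_simps)
  qed
  have lin: "Lp_norm p (\<lambda>x. T (\<lambda>y. a * g y + b * h y) x - (a * T g x + b * T h x)) = 0"
    if "g \<in> Lp p" "h \<in> Lp p" for g h a b
    using T_linear[OF that] by (simp add: Lp_norm_eq)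
  show ?thesis
    unfolding contains_copy_of_Lp_def
    by (intro exI[of _ T] exI[of _ "1 / D"] exI[of _ D] conjI ballI allI)
      (simp_all only: D T_Xp up lo lin zero_less_divide_1_iff)
qed

end

theorem theorem2p15:
  fixes p :: real
  assumes "4 < p"
  shows "\<exists>(f :: real \<Rightarrow> real) (\<Lambda> :: int set). f \<in> Lp p \<and> unconditional_basic p f \<Lambda> \<and>
           contains_copy_of_Lp p (Xp p f \<Lambda>)"
proof -
  interpret haar_translates p by standard (rule assms)
  show ?thesis using f_Lp unconditional[OF f_pos] contains_copy by blast
qed

end
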